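(* Let $\mathbb{K}$ be a field of characteristic zero, let $d\ge 2$ and $n\ge 4$ be integers, and let $I\subset S=\mathbb{K}[x_1,\dots,x_n]$ be an artinian monomial ideal generated in degree $d$ such that $S/I$ fails to have the weak Lefschetz property. Then $$H_{S/I}(d)\ge 2d.$$ Furthermore, the bound is sharp: for all $n\ge 4$ and $d\ge 2$ there is an artinian monomial ideal $I\subset S$ generated in degree $d$ such that $S/I$ fails the weak Lefschetz property and $H_{S/I}(d)=2d$.
   Context: $S$ has the standard grading, $\deg x_i=1$. An ideal is "generated in degree $d$" if it is generated by homogeneous elements, all of degree $d$. $H_{S/I}(d)=\dim_{\mathbb{K}}(S/I)_d$ is the Hilbert function. For a homogeneous artinian ideal $I$, $S/I$ has the weak Lefschetz property (WLP) if there is a linear form $\ell\in (S/I)_1$ such that for all integers $j$ the multiplication map $\times\ell:(S/I)_j\to(S/I)_{j+1}$ is injective or surjective; otherwise $S/I$ fails the WLP. *)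

theory Defs
  imports
    "HOL-Algebra.Embedded_Algebras"
    "HOL-Algebra.QuotRing"
    "HOL-Library.Poly_Mapping"
begin

text \<open>
  A monomial is its exponent vector, of type \<open>nat \<Rightarrow>\<^sub>0 nat\<close>, and a polynomial is a finitely
  supported map from monomials to coefficients; the ring operations on polynomials are those of
  \<^theory>\<open>HOL-Library.Poly_Mapping\<close>. The \<open>n\<close> variables \<open>x\<^sub>1, \<dots>, x\<^sub>n\<close> carry the indices
  \<open>0, \<dots>, n - 1\<close>.
\<close>

type_synonym 'k mpoly = "(nat \<Rightarrow>\<^sub>0 nat) \<Rightarrow>\<^sub>0 'k"

definition mpoly_ring :: "nat \<Rightarrow> 'k::field mpoly ring" where
  "mpoly_ring n =
     \<lparr>carrier = {p. \<forall>m\<in>Poly_Mapping.keys p. Poly_Mapping.keys m \<subseteq> {..<n}},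
      mult = (*), one = 1, zero = 0, add = (+)\<rparr>"

definition total_degree :: "(nat \<Rightarrow>\<^sub>0 nat) \<Rightarrow> nat" where
  "total_degree m = (\<Sum>i\<in>Poly_Mapping.keys m. Poly_Mapping.lookup m i)"

text \<open>The grading is indexed by all integers; the components of negative degree are \<open>{0}\<close>.\<close>

definition graded_part :: "nat \<Rightarrow> int \<Rightarrow> 'k::field mpoly set" where
  "graded_part n j =
     {p \<in> carrier (mpoly_ring n). \<forall>m\<in>Poly_Mapping.keys p. int (total_degree m) = j}"

definition monomials :: "nat \<Rightarrow> 'k::field mpoly set" where
  "monomials n = {Poly_Mapping.single m 1 | m. Poly_Mapping.keys m \<subseteq> {..<n}}"

definition monomial_ideal :: "nat \<Rightarrow> 'k::field mpoly set \<Rightarrow> bool" where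
  "monomial_ideal n I \<longleftrightarrow> (\<exists>G\<subseteq>monomials n. I = Idl\<^bsub>mpoly_ring n\<^esub> G)"

definition generated_in_degree :: "nat \<Rightarrow> int \<Rightarrow> 'k::field mpoly set \<Rightarrow> bool" where
  "generated_in_degree n d I \<longleftrightarrow> (\<exists>G\<subseteq>graded_part n d. I = Idl\<^bsub>mpoly_ring n\<^esub> G)"

definition artinian_ring :: "('a, 'b) ring_scheme \<Rightarrow> bool" where
  "artinian_ring R \<longleftrightarrow> cring R \<and>
     (\<forall>J :: nat \<Rightarrow> 'a set.
        (\<forall>k. ideal (J k) R \<and> J (Suc k) \<subseteq> J k) \<longrightarrow> (\<exists>N. \<forall>k\<ge>N. J k = J N))"

definition artinian_ideal :: "nat \<Rightarrow> 'k::field mpoly set \<Rightarrow> bool" where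
  "artinian_ideal n I \<longleftrightarrow> ideal I (mpoly_ring n) \<and> artinian_ring (mpoly_ring n Quot I)"

text \<open>
  The next two sets live in \<open>S/I\<close>, whose elements are cosets: the image of the coefficient field,
  and the image of the component of degree \<open>j\<close> of \<open>S\<close>, which for homogeneous \<open>I\<close> is the
  graded component of degree \<open>j\<close> of \<open>S/I\<close>.
\<close>

definition quot_scalars :: "nat \<Rightarrow> 'k::field mpoly set \<Rightarrow> 'k mpoly set set" where
  "quot_scalars n I = {I +>\<^bsub>mpoly_ring n\<^esub> Poly_Mapping.single 0 c | c. True}"

definition quot_graded_part :: "nat \<Rightarrow> 'k::field mpoly set \<Rightarrow> int \<Rightarrow> 'k mpoly set set" where
  "quot_graded_part n I j = (\<lambda>p. I +>\<^bsub>mpoly_ring n\<^esub> p) ` graded_part n j"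

text \<open>
  For proper \<open>I\<close> the scalars form a subfield of \<open>S/I\<close> isomorphic to the coefficient field, as
  \<^const>\<open>ring.dim\<close> requires. For \<open>I = S\<close> its value is unspecified.
\<close>

definition hilbert_function :: "nat \<Rightarrow> 'k::field mpoly set \<Rightarrow> int \<Rightarrow> nat" where
  "hilbert_function n I j =
     ring.dim (mpoly_ring n Quot I) (quot_scalars n I) (quot_graded_part n I j)"

definition weak_lefschetz :: "nat \<Rightarrow> 'k::field mpoly set \<Rightarrow> bool" where
  "weak_lefschetz n I \<longleftrightarrow>
     (\<exists>l\<in>quot_graded_part n I 1. \<forall>j.
        inj_on (\<lambda>x. l \<otimes>\<^bsub>mpoly_ring n Quot I\<^esub> x) (quot_graded_part n I j) \<or>
        (\<lambda>x. l \<otimes>\<^bsub>mpoly_ring n Quot I\<^esub> x) ` quot_graded_part n I j = quot_graded_part n I (j + 1))"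

end

theory Submission
  imports Defs
begin

text \<open>
  Below degree \<open>d\<close> the ideal vanishes, so multiplication by \<open>\<ell> = x\<^sub>1 + \<dots> + x\<^sub>n\<close> is injective there, and
  once it maps onto degree \<open>d\<close> it maps onto every higher degree. If it is not onto degree \<open>d\<close>, duality
  yields a nonzero form \<open>f\<close> of degree \<open>d\<close> killed by \<open>\<partial>\<^sub>1 + \<dots> + \<partial>\<^sub>n\<close> and supported on the monomials
  outside \<open>I\<close>, so without pure powers. Let \<open>a\<close> be the degree of \<open>f\<close> in one of its variables \<open>x\<^sub>j\<close>; then
  \<open>1 \<le> a < d\<close>. Each of the \<open>a + 1\<close> slices of the support with fixed exponent of \<open>x\<^sub>j\<close> is nonempty, and
  the coefficients of \<open>f\<close> on a slice annihilate all polynomials of degree less than \<open>d - a\<close> in the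
  exponents. Products of linear polynomials separate points, so a slice has at least \<open>d - a + 1\<close>
  elements, and \<open>(a + 1) (d - a + 1) \<ge> 2 d\<close>. The bound is attained by the ideal whose complement in
  degree \<open>d\<close> is the support of \<open>(x\<^sub>1 - x\<^sub>2) (x\<^sub>3 - x\<^sub>4)\<^sup>d\<^sup>-\<^sup>1\<close>.
\<close>

section \<open>Forms killed by the sum of the partial derivatives\<close>

abbreviation (input) keys where "keys \<equiv> Poly_Mapping.keys"
abbreviation (input) lookup where "lookup \<equiv> Poly_Mapping.lookup"
abbreviation (input) single where "single \<equiv> Poly_Mapping.single"

section \<open>Exponent vectors of fixed total degree\<close>

definition mons :: "nat \<Rightarrow> nat \<Rightarrow> (nat \<Rightarrow>\<^sub>0 nat) set" where
  "mons n k = {m. keys m \<subseteq> {..<n} \<and> total_degree m = k}"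

lemma keys_add_nat: "keys (a + b) = keys a \<union> keys (b :: 'a \<Rightarrow>\<^sub>0 nat)"
  by (auto simp: in_keys_iff lookup_add)

lemma total_degree_eq_sum:
  assumes "keys m \<subseteq> A" "finite A"
  shows "total_degree m = (\<Sum>i\<in>A. lookup m i)"
  unfolding total_degree_def
  by (rule sum.mono_neutral_left) (use assms in \<open>auto simp: in_keys_iff\<close>)

lemma total_degree_add: "total_degree (a + b) = total_degree a + total_degree b"
proof -
  let ?A = "keys a \<union> keys b"
  show ?thesis
    using total_degree_eq_sum[of "a + b" ?A] total_degree_eq_sum[of a ?A]
      total_degree_eq_sum[of b ?A]
    by (simp add: keys_add_nat lookup_add sum.distrib)
qed

lemma total_degree_single [simp]: "total_degree (single i k) = k"
  by (cases "k = 0") (auto simp: total_degree_def)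

lemma lookup_le_total_degree: "lookup m i \<le> total_degree m"
proof (cases "i \<in> keys m")
  case True
  then show ?thesis
    unfolding total_degree_def by (rule member_le_sum) auto
qed (simp add: in_keys_iff)

lemma mons_lookup_ge: "m \<in> mons n k \<Longrightarrow> i \<ge> n \<Longrightarrow> lookup m i = 0"
  by (auto simp: mons_def in_keys_iff subset_iff)

lemma mons_total: "m \<in> mons n k \<Longrightarrow> (\<Sum>i<n. lookup m i) = k"
  using total_degree_eq_sum[of m "{..<n}"] by (auto simp: mons_def)

lemma finite_bounded_exponents:
  "finite {m :: nat \<Rightarrow>\<^sub>0 nat. keys m \<subseteq> {..<n} \<and> (\<forall>i. lookup m i \<le> k)}"
proof -
  let ?F = "{f. \<forall>i. (i \<in> {..<n} \<longrightarrow> f i \<in> {..k}) \<and> (i \<notin> {..<n} \<longrightarrow> f i = 0)}"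
  have "finite ?F" by (rule finite_set_of_finite_funs) auto
  moreover have "lookup ` {m. keys m \<subseteq> {..<n} \<and> (\<forall>i. lookup m i \<le> k)} \<subseteq> ?F"
    by (auto simp: in_keys_iff subset_iff)
  ultimately have "finite (lookup ` {m. keys m \<subseteq> {..<n} \<and> (\<forall>i. lookup m i \<le> k)})"
    by (rule rev_finite_subset)
  moreover have "inj_on lookup A" for A :: "(nat \<Rightarrow>\<^sub>0 nat) set"
    by (auto simp: inj_on_def)
  ultimately show ?thesis by (rule finite_imageD)
qed

lemma finite_mons [simp]: "finite (mons n k)"
  by (rule finite_subset[OF _ finite_bounded_exponents[of n k]])
     (auto simp: mons_def lookup_le_total_degree)

lemma mons_add_single: "m \<in> mons n k \<Longrightarrow> i < n \<Longrightarrow> m + single i 1 \<in> mons n (Suc k)"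
  by (auto simp: mons_def keys_add_nat total_degree_add)

lemma mons_Suc_cases:
  assumes "m \<in> mons n (Suc k)" "lookup m i \<noteq> 0"
  obtains m' where "m = m' + single i 1" "m' \<in> mons n k" "i < n"
proof
  define m' where "m' = m - single i 1"
  show eq: "m = m' + single i 1"
    using assms(2)
    by (intro poly_mapping_eqI) (auto simp: m'_def lookup_add lookup_minus lookup_single when_def)
  show "m' \<in> mons n k"
    using assms(1) unfolding eq by (auto simp: mons_def keys_add_nat total_degree_add)
  show "i < n" using assms by (auto simp: mons_def in_keys_iff subset_iff)
qed

text \<open>
  The locale assumption says that every coefficient of \<open>(\<partial>\<^sub>1 + \<dots> + \<partial>\<^sub>n) f\<close> vanishes, where \<open>f\<close> is the
  form of degree \<open>d + 1\<close> with coefficients \<open>w\<close>.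
\<close>

locale kernel_form =
  fixes n d :: nat and w :: "(nat \<Rightarrow>\<^sub>0 nat) \<Rightarrow> 'k::field_char_0"
  assumes rec: "\<And>m. m \<in> mons n d \<Longrightarrow>
      (\<Sum>i<n. of_nat (Suc (lookup m i)) * w (m + single i 1)) = 0"
begin

text \<open>The transpose of the derivation: weight \<open>rec\<close> at \<open>b\<close> by
  \<open>q b\<close> and reindex each summand by \<open>m = b + single i 1\<close>. The moment
  identities below come from a choice of \<open>q\<close>.\<close>

lemma sum_by_parts:
  "(\<Sum>m\<in>mons n (Suc d). w m * (\<Sum>i<n. of_nat (lookup m i) * q (m - single i 1))) = 0"
proof -
  have shift: "(\<Sum>b\<in>mons n d. of_nat (Suc (lookup b i)) * w (b + single i 1) * q b) =
        (\<Sum>m\<in>mons n (Suc d). w m * (of_nat (lookup m i) * q (m - single i 1)))" (is "?L = ?R")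
    if i: "i < n" for i
  proof -
    have "?L = (\<Sum>m\<in>(\<lambda>b. b + single i 1) ` mons n d.
                  w m * (of_nat (lookup m i) * q (m - single i 1)))"
      by (subst sum.reindex)
         (auto simp: inj_on_def lookup_add algebra_simps intro!: sum.cong)
    also have "\<dots> = ?R"
    proof (rule sum.mono_neutral_left)
      show "(\<lambda>b. b + single i 1) ` mons n d \<subseteq> mons n (Suc d)"
        using i mons_add_single by auto
      \<comment> \<open>A monomial missed by the shift does not contain the variable
        \<open>i\<close>, so the factor \<open>lookup m i\<close> is zero. This also makes the
        truncated subtraction in \<open>m - single i 1\<close> harmless.\<close>
      show "\<forall>m\<in>mons n (Suc d) - (\<lambda>b. b + single i 1) ` mons n d.
              w m * (of_nat (lookup m i) * q (m - single i 1)) = 0"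
        by (auto elim: mons_Suc_cases)
    qed simp
    finally show ?thesis .
  qed
  have "0 = (\<Sum>b\<in>mons n d. (\<Sum>i<n. of_nat (Suc (lookup b i)) * w (b + single i 1)) * q b)"
    by (simp only: rec mult_zero_left sum.neutral_const cong: sum.cong)
  also have "\<dots> = (\<Sum>i<n. \<Sum>b\<in>mons n d. of_nat (Suc (lookup b i)) * w (b + single i 1) * q b)"
    by (simp only: sum_distrib_right) (rule sum.swap)
  also have "\<dots> = (\<Sum>i<n. \<Sum>m\<in>mons n (Suc d). w m * (of_nat (lookup m i) * q (m - single i 1)))"
    by (intro sum.cong shift) auto
  also have "\<dots> = (\<Sum>m\<in>mons n (Suc d). \<Sum>i<n. w m * (of_nat (lookup m i) * q (m - single i 1)))"
    by (rule sum.swap)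
  finally show ?thesis by (simp add: sum_distrib_left)
qed

section \<open>Moments of the coefficients on slices, and the support bound\<close>

definition slice :: "nat \<Rightarrow> nat \<Rightarrow> (nat \<Rightarrow>\<^sub>0 nat) set" where
  "slice j k = {m\<in>mons n (Suc d). lookup m j = k}"

text \<open>Products of binomial coefficients span the polynomials in the exponents. They replace
  powers because lowering an exponent merely multiplies them by a linear factor, and over all
  variables these factors sum to a scalar on each degree.\<close>

definition bin :: "(nat \<Rightarrow> nat) \<Rightarrow> (nat \<Rightarrow>\<^sub>0 nat) \<Rightarrow> 'k" where
  "bin g m = (\<Prod>i<n. of_nat (lookup m i choose g i))"

lemma finite_slice [simp]: "finite (slice j k)"
  by (simp add: slice_def)

text \<open>In one variable this is r C(r - 1, s) = (r - s) C(r, s); the other factors of the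
  product do not see the shift.\<close>

lemma times_bin_minus_single:
  assumes "i < n"
  shows "of_nat (lookup m i) * bin g (m - single i 1) =
         (of_nat (lookup m i) - of_nat (g i)) * bin g m"
proof -
  have split: "bin g m' = of_nat (lookup m' i choose g i) *
        (\<Prod>j\<in>{..<n} - {i}. of_nat (lookup m' j choose g j))" for m'
    unfolding bin_def using assms by (subst prod.remove[of _ i]) auto
  have rest: "(\<Prod>j\<in>{..<n} - {i}. of_nat (lookup (m - single i 1) j choose g j)) =
        (\<Prod>j\<in>{..<n} - {i}. (of_nat (lookup m j choose g j) :: 'k))"
    by (intro prod.cong) (auto simp: lookup_minus lookup_single)
  \<comment> \<open>Stated as a sum so that no truncated difference of exponents enters before the
    passage to the field.\<close>
  have "lookup m i * ((lookup m i - 1) choose g i) + g i * (lookup m i choose g i) =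
        lookup m i * (lookup m i choose g i)"
  proof (cases "lookup m i")
    case (Suc r)
    show ?thesis
    proof (cases "g i")
      case (Suc s)
      have "Suc s * (Suc r choose Suc s) = Suc r * (r choose s)"
        by (rule Suc_times_binomial)
      then show ?thesis
        using Suc \<open>lookup m i = Suc r\<close> by (simp add: algebra_simps)
    qed (use Suc in auto)
  qed (cases "g i", auto)
  then have "of_nat (lookup m i * ((lookup m i - 1) choose g i) + g i * (lookup m i choose g i)) =
        (of_nat (lookup m i * (lookup m i choose g i)) :: 'k)" by simp
  then have "of_nat (lookup m i) * of_nat ((lookup m i - 1) choose g i) =
        (of_nat (lookup m i) - of_nat (g i)) * (of_nat (lookup m i choose g i) :: 'k)"
    by (simp add: algebra_simps)
  then show ?thesis
    unfolding split[of m] split[of "m - single i 1"] rest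
    by (simp add: lookup_minus mult.assoc[symmetric])
qed

text \<open>Apply \<open>sum_by_parts\<close> to \<open>bin g\<close> cut off to exponent
  \<open>k\<close> of variable \<open>j\<close>. Differentiation in \<open>j\<close> sees slice
  \<open>k + 1\<close>; the other variables stay in slice \<open>k\<close>, where their exponents
  sum to \<open>d + 1 - k\<close>. As \<open>g\<close> ignores \<open>j\<close>, a two-term
  recursion between neighbouring slices results.\<close>

lemma slice_moment_step:
  assumes j: "j < n" and g: "g j = 0"
  shows "of_nat (Suc k) * (\<Sum>m\<in>slice j (Suc k). w m * bin g m) +
         (of_nat (Suc d) - of_nat k - of_nat (\<Sum>i<n. g i)) * (\<Sum>m\<in>slice j k. w m * bin g m) = 0"
proof -
  define q where "q b = (if lookup b j = k then bin g b else 0)" for b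
  have inner: "(\<Sum>i<n. of_nat (lookup m i) * q (m - single i 1)) =
      (if lookup m j = Suc k then of_nat (Suc k) * bin g m else 0) +
      (if lookup m j = k then (of_nat (Suc d) - of_nat k - of_nat (\<Sum>i<n. g i)) * bin g m else 0)"
    if m: "m \<in> mons n (Suc d)" for m
  proof -
    have "(\<Sum>i<n. of_nat (lookup m i) * q (m - single i 1)) =
      of_nat (lookup m j) * q (m - single j 1) +
      (\<Sum>i\<in>{..<n} - {j}. of_nat (lookup m i) * q (m - single i 1))"
      using j by (subst sum.remove[of _ j]) auto
    also have "of_nat (lookup m j) * q (m - single j 1) =
        (if lookup m j = Suc k then of_nat (Suc k) * bin g m else 0)"
      using times_bin_minus_single[OF j, of m g] g
      by (cases "lookup m j") (auto simp: q_def lookup_minus)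
    also have "(\<Sum>i\<in>{..<n} - {j}. of_nat (lookup m i) * q (m - single i 1)) =
        (\<Sum>i\<in>{..<n} - {j}. if lookup m j = k
           then (of_nat (lookup m i) - of_nat (g i)) * bin g m else 0)"
      using times_bin_minus_single[of _ m g]
      by (intro sum.cong) (auto simp: q_def lookup_minus lookup_single)
    also have "\<dots> = (if lookup m j = k then
        (\<Sum>i\<in>{..<n} - {j}. of_nat (lookup m i) - of_nat (g i)) * bin g m else 0)"
      by (simp add: sum_distrib_right)
    also have "(\<Sum>i\<in>{..<n} - {j}. of_nat (lookup m i) - of_nat (g i)) =
        (\<Sum>i<n. of_nat (lookup m i) - (of_nat (g i) :: 'k)) - of_nat (lookup m j)"
      using j g by (subst sum.remove[of "{..<n}" j]) auto
    also have "(\<Sum>i<n. of_nat (lookup m i) - (of_nat (g i) :: 'k)) =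
        of_nat (Suc d) - of_nat (\<Sum>i<n. g i)"
      using mons_total[OF m] by (simp only: sum_subtractf flip: of_nat_sum)
    finally show ?thesis by (simp add: algebra_simps)
  qed
  have "0 = (\<Sum>m\<in>mons n (Suc d). w m * (\<Sum>i<n. of_nat (lookup m i) * q (m - single i 1)))"
    by (simp only: sum_by_parts)
  also have "\<dots> = (\<Sum>m\<in>mons n (Suc d).
      (if lookup m j = Suc k then of_nat (Suc k) * (w m * bin g m) else 0) +
      (if lookup m j = k then
        (of_nat (Suc d) - of_nat k - of_nat (\<Sum>i<n. g i)) * (w m * bin g m) else 0))"
    by (intro sum.cong refl, subst inner) (simp_all only: distrib_left mult.left_commute if_distrib[of "(*) _"] mult_zero_right)
  also have "\<dots> = (\<Sum>m\<in>slice j (Suc k). of_nat (Suc k) * (w m * bin g m)) +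
      (\<Sum>m\<in>slice j k.
        (of_nat (Suc d) - of_nat k - of_nat (\<Sum>i<n. g i)) * (w m * bin g m))"
    unfolding slice_def sum.distrib by (simp only: sum.inter_filter finite_mons)
  finally show ?thesis by (simp only: sum_distrib_left)
qed

text \<open>Downward induction on \<open>k\<close> from slice \<open>a + 1\<close>, on which
  \<open>w\<close> vanishes. The factor \<open>d + 1 - k - |g|\<close> is a positive integer for
  \<open>k \<le> a\<close>, hence nonzero in characteristic zero.\<close>

lemma slice_moment_zero:
  assumes j: "j < n" "g j = 0" and a: "\<And>m. m \<in> mons n (Suc d) \<Longrightarrow> w m \<noteq> 0 \<Longrightarrow> lookup m j \<le> a"
    and deg: "(\<Sum>i<n. g i) + a < Suc d" and "k \<le> Suc a"
  shows "(\<Sum>m\<in>slice j k. w m * bin g m) = 0"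
  using \<open>k \<le> Suc a\<close>
proof (induction rule: inc_induct)
  case base
  have "w m = 0" if "m \<in> slice j (Suc a)" for m
    using that a[of m] by (force simp: slice_def)
  then show ?case by simp
next
  case (step k)
  have "(of_nat (Suc d) - of_nat k - of_nat (\<Sum>i<n. g i)) = (of_nat (Suc d - k - (\<Sum>i<n. g i)) :: 'k)"
    using deg step.hyps by (simp add: of_nat_diff)
  moreover have "(of_nat (Suc d - k - (\<Sum>i<n. g i)) :: 'k) \<noteq> 0"
    using deg step.hyps by (simp only: of_nat_eq_0_iff)
  ultimately have "of_nat (Suc d) - of_nat k - of_nat (\<Sum>i<n. g i) \<noteq> (0 :: 'k)" by metis
  then show ?case
    using slice_moment_step[where j = j and g = g and k = k, OF j]
    unfolding step.IH mult_zero_right add_0 mult_eq_0_iff by blast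
qed

text \<open>By (r - s) C(r, s) = (s + 1) C(r, s + 1), a linear factor raises the degree of a
  binomial product by at most one. Products of linear factors can thus be expanded in the
  \<open>bin g\<close>.\<close>

lemma bin_times_linear:
  assumes "i < n"
  shows "bin g m * (of_nat (lookup m i) - c) =
    (of_nat (g i) - c) * bin g m + of_nat (Suc (g i)) * bin (g(i := Suc (g i))) m"
proof -
  have split: "bin h m = of_nat (lookup m i choose h i) *
        (\<Prod>j\<in>{..<n} - {i}. of_nat (lookup m j choose h j))" for h
    unfolding bin_def using assms by (subst prod.remove[of _ i]) auto
  have rest: "(\<Prod>j\<in>{..<n} - {i}. of_nat (lookup m j choose (g(i := Suc (g i))) j)) =
        (\<Prod>j\<in>{..<n} - {i}. (of_nat (lookup m j choose g j) :: 'k))"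
    by (intro prod.cong) auto
  have "Suc s * (r choose Suc s) + s * (r choose s) = r * (r choose s)" for r s :: nat
  proof (cases "s \<le> r")
    case True
    have "Suc s * (r choose Suc s) = (r - s) * (r choose s)"
      using binomial_absorb_comp[of r s] Suc_times_binomial[of s "r - 1"]
      by (cases r) (simp_all only: diff_Suc_1, simp)
    then show ?thesis using True by (simp only: le_add_diff_inverse2 flip: add_mult_distrib)
  qed (simp add: binomial_eq_0)
  from arg_cong[OF this[of "g i" "lookup m i"], of "of_nat :: nat \<Rightarrow> 'k"]
  have "of_nat (lookup m i choose g i) * (of_nat (lookup m i) - c) =
    (of_nat (g i) - c) * of_nat (lookup m i choose g i) +
    of_nat (Suc (g i)) * of_nat (lookup m i choose Suc (g i))"
    by (simp add: algebra_simps)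
  then have *: "(of_nat (lookup m i choose g i) * (of_nat (lookup m i) - c)) * r =
    (of_nat (g i) - c) * (of_nat (lookup m i choose g i) * r) +
    of_nat (Suc (g i)) * (of_nat (lookup m i choose Suc (g i)) * r)" for r
    by (simp only: distrib_right mult.assoc)
  show ?thesis
    unfolding split[of g] split[of "g(i := Suc (g i))"] rest
    using *[of "\<Prod>j\<in>{..<n} - {i}. of_nat (lookup m j choose g j)"]
    by (simp only: mult.assoc mult.left_commute mult.commute fun_upd_same)
qed

text \<open>Each factor is expanded by \<open>bin_times_linear\<close>, so the induction runs over
  all \<open>g\<close> and every factor counts as one degree. Factors in variable \<open>j\<close>
  are excluded to keep \<open>g j = 0\<close>.\<close>

lemma slice_moment_linear_zero:
  assumes j: "j < n" "g j = 0" and a: "\<And>m. m \<in> mons n (Suc d) \<Longrightarrow> w m \<noteq> 0 \<Longrightarrow> lookup m j \<le> a"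
    and deg: "(\<Sum>i<n. g i) + length L + a < Suc d" and k: "k \<le> a"
    and L: "\<forall>(i, c)\<in>set L. i < n \<and> i \<noteq> j"
  shows "(\<Sum>m\<in>slice j k. w m * bin g m * (\<Prod>(i, c)\<leftarrow>L. of_nat (lookup m i) - c)) = 0"
  using j(2) deg L
proof (induction L arbitrary: g)
  case Nil
  then show ?case using slice_moment_zero[where j = j and g = g and a = a and k = k] j(1) a k by simp
next
  case (Cons p L)
  obtain i c where p: "p = (i, c)" by (cases p)
  have i: "i < n" "i \<noteq> j" using Cons.prems p by auto
  let ?g = "g(i := Suc (g i))"
  let ?P = "\<lambda>m. (\<Prod>(i, c)\<leftarrow>L. of_nat (lookup m i) - c)"
  have "(\<Sum>i<n. ?g i) = Suc (\<Sum>i<n. g i)"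
    using i by (subst (1 2) sum.remove[of _ i]) auto
  then have g': "(\<Sum>m\<in>slice j k. w m * bin ?g m * ?P m) = 0"
    using Cons.prems i by (intro Cons.IH) auto
  have g: "(\<Sum>m\<in>slice j k. w m * bin g m * ?P m) = 0"
    using Cons.prems by (intro Cons.IH) auto
  have "w m * bin g m * ((of_nat (lookup m i) - c) * ?P m) =
      (of_nat (g i) - c) * (w m * bin g m * ?P m) + of_nat (Suc (g i)) * (w m * bin ?g m * ?P m)" for m
  proof -
    have "w m * bin g m * ((of_nat (lookup m i) - c) * ?P m) =
        w m * (bin g m * (of_nat (lookup m i) - c)) * ?P m" by (simp add: mult_ac)
    then show ?thesis unfolding bin_times_linear[OF i(1)] by (simp add: algebra_simps)
  qed
  then show ?case
    using g g' by (simp add: p sum.distrib flip: sum_distrib_left)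
qed

text \<open>With at most \<open>d + 1 - a\<close> support points, take one linear factor for each
  point other than \<open>m0\<close>, vanishing there but not at \<open>m0\<close>. The product has
  degree at most \<open>d - a\<close>, so its moment is zero, yet the moment reduces to a nonzero
  multiple of \<open>w m0\<close>.\<close>

lemma card_slice_ge:
  assumes j: "j < n" and a: "\<And>m. m \<in> mons n (Suc d) \<Longrightarrow> w m \<noteq> 0 \<Longrightarrow> lookup m j \<le> a"
    and a_le: "a \<le> Suc d" and k: "k \<le> a" and ne: "m0 \<in> slice j k" "w m0 \<noteq> 0"
  shows "Suc (Suc d) - a \<le> card {m\<in>slice j k. w m \<noteq> 0}" (is "_ \<le> card ?M")
proof (rule ccontr)
  assume "\<not> ?thesis"
  then have less: "card ?M + a < Suc (Suc d)" by linarith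
  \<comment> \<open>A coordinate separating \<open>m\<close> from \<open>m0\<close>. It differs from
    \<open>j\<close> because both points lie in one slice.\<close>
  define f where "f m = (SOME i. lookup m i \<noteq> lookup m0 i)" for m
  obtain xs where xs: "set xs = ?M - {m0}" "distinct xs"
    using finite_distinct_list[of "?M - {m0}"] by auto
  have len: "Suc (length xs) = card ?M"
    using xs ne distinct_card[of xs] card_Suc_Diff1[of ?M m0] by simp
  define L where "L = map (\<lambda>m. (f m, of_nat (lookup m (f m)) :: 'k)) xs"
  have f: "f m < n" "f m \<noteq> j" "lookup m (f m) \<noteq> lookup m0 (f m)" if "m \<in> set xs" for m
  proof -
    have m: "m \<in> slice j k" "m \<noteq> m0" using that xs by auto
    then have "\<exists>i. lookup m i \<noteq> lookup m0 i" using poly_mapping_eqI[of m m0] by auto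
    then show *: "lookup m (f m) \<noteq> lookup m0 (f m)" unfolding f_def by (rule someI_ex)
    have "m \<in> mons n (Suc d)" "m0 \<in> mons n (Suc d)" "lookup m j = lookup m0 j"
      using m ne by (auto simp: slice_def)
    then show "f m < n" "f m \<noteq> j"
      using * mons_lookup_ge[of m n "Suc d" "f m"] mons_lookup_ge[of m0 n "Suc d" "f m"]
      by (cases "f m < n"; force)+
  qed
  have zero: "(\<Sum>m\<in>slice j k. w m * bin (\<lambda>_. 0) m * (\<Prod>(i, c)\<leftarrow>L. of_nat (lookup m i) - c)) = 0"
  proof (rule slice_moment_linear_zero[where a = a])
    show "(\<Sum>i<n. 0) + length L + a < Suc d" using less len by (simp add: L_def)
    show "\<forall>(i, c)\<in>set L. i < n \<and> i \<noteq> j" using f by (auto simp: L_def)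
  qed (use j a k in auto)
  have prod: "(\<Prod>(i, c)\<leftarrow>L. of_nat (lookup m i) - c) =
      (\<Prod>x\<leftarrow>xs. of_nat (lookup m (f x)) - of_nat (lookup x (f x)))" for m
    by (simp add: L_def o_def)
  have "(\<Sum>m\<in>slice j k. w m * bin (\<lambda>_. 0) m * (\<Prod>(i, c)\<leftarrow>L. of_nat (lookup m i) - c)) =
      (\<Sum>m\<in>{m0}. w m * bin (\<lambda>_. 0) m * (\<Prod>(i, c)\<leftarrow>L. of_nat (lookup m i) - c))"
  proof (rule sum.mono_neutral_right)
    show "\<forall>m\<in>slice j k - {m0}. w m * bin (\<lambda>_. 0) m * (\<Prod>(i, c)\<leftarrow>L. of_nat (lookup m i) - c) = 0"
    proof
      fix m assume m: "m \<in> slice j k - {m0}"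
      show "w m * bin (\<lambda>_. 0) m * (\<Prod>(i, c)\<leftarrow>L. of_nat (lookup m i) - c) = 0"
      proof (cases "w m = 0")
        case False
        with m xs have "m \<in> set xs" by auto
        then have "(\<Prod>x\<leftarrow>xs. of_nat (lookup m (f x)) - of_nat (lookup x (f x)) :: 'k) = 0"
          by (auto simp: prod_list_zero_iff)
        then show ?thesis by (simp add: prod)
      qed simp
    qed
  qed (use ne in auto)
  then have "w m0 * bin (\<lambda>_. 0) m0 *
      (\<Prod>x\<leftarrow>xs. of_nat (lookup m0 (f x)) - of_nat (lookup x (f x))) = 0"
    using zero by (simp add: prod)
  moreover have "bin (\<lambda>_. 0) m0 = 1" by (simp add: bin_def)
  moreover have "(\<Prod>x\<leftarrow>xs. of_nat (lookup m0 (f x)) - of_nat (lookup x (f x)) :: 'k) \<noteq> 0"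
    using f by (force simp: prod_list_zero_iff)
  ultimately show False using ne by simp
qed

text \<open>Descend one slice at a time: if \<open>w\<close> is nonzero at
  \<open>m = b + single j 1\<close> in slice \<open>k + 1\<close>, the other terms of
  \<open>rec\<close> at \<open>b\<close> lie in slice \<open>k\<close>. They cannot all vanish,
  because the coefficient \<open>k + 1\<close> of \<open>w m\<close> is nonzero.\<close>

lemma slice_nonzero:
  assumes j: "j < n" and "m \<in> slice j a" "w m \<noteq> 0" "k \<le> a"
  shows "\<exists>m\<in>slice j k. w m \<noteq> 0"
  using \<open>k \<le> a\<close>
proof (induction rule: inc_induct)
  case base
  then show ?case using assms by auto
next
  case (step k)
  then obtain m where m: "m \<in> mons n (Suc d)" "lookup m j = Suc k" "w m \<noteq> 0"
    by (auto simp: slice_def)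
  then obtain b where b: "m = b + single j 1" "b \<in> mons n d"
    by (metis mons_Suc_cases nat.distinct(1))
  show ?case
  proof (rule ccontr)
    assume none: "\<not> ?case"
    have "w (b + single i 1) = 0" if "i < n" "i \<noteq> j" for i
      using none that b m mons_add_single[OF b(2) that(1)]
      by (auto simp: slice_def lookup_add lookup_single)
    then have "(\<Sum>i<n. of_nat (Suc (lookup b i)) * w (b + single i 1)) =
        of_nat (Suc (lookup b j)) * w (b + single j 1)"
      using j by (subst sum.remove[of _ j]) auto
    with rec[OF b(2)] m b show False by (simp del: of_nat_Suc)
  qed
qed

theorem card_support_ge:
  assumes pure: "\<And>i. i < n \<Longrightarrow> w (single i (Suc d)) = 0"
    and m0: "m0 \<in> mons n (Suc d)" "w m0 \<noteq> 0"
  shows "2 * Suc d \<le> card {m\<in>mons n (Suc d). w m \<noteq> 0}"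
proof -
  have "\<exists>j. lookup m0 j \<noteq> 0"
    using mons_total[OF m0(1)] by (metis nat.distinct(1) sum.neutral)
  then obtain j where j0: "lookup m0 j \<noteq> 0" by blast
  have j: "j < n" using j0 m0 mons_lookup_ge by (metis not_le_imp_less)
  let ?M = "{m\<in>mons n (Suc d). w m \<noteq> 0}"
  define a where "a = Max ((\<lambda>m. lookup m j) ` ?M)"
  have a_max: "lookup m j \<le> a" if "m \<in> mons n (Suc d)" "w m \<noteq> 0" for m
    unfolding a_def using that by (intro Max_ge) auto
  have "a \<in> (\<lambda>m. lookup m j) ` ?M"
    unfolding a_def using m0 by (intro Max_in) auto
  then obtain ma where ma: "ma \<in> mons n (Suc d)" "w ma \<noteq> 0" "lookup ma j = a" by auto
  have a1: "1 \<le> a" using a_max[OF m0] j0 by simp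
  have a_le: "a \<le> Suc d"
    using lookup_le_total_degree[of ma j] ma by (auto simp: mons_def)
  \<comment> \<open>Exponent \<open>d + 1\<close> would make \<open>ma\<close> a pure power, where
    \<open>w\<close> vanishes.\<close>
  have "a \<noteq> Suc d"
  proof
    assume "a = Suc d"
    then have "(\<Sum>i\<in>{..<n} - {j}. lookup ma i) = 0"
      using mons_total[OF ma(1)] ma(3) j by (subst (asm) sum.remove[of _ j]) auto
    then have "lookup ma i = (if i = j then Suc d else 0)" for i
      using ma mons_lookup_ge[OF ma(1), of i] \<open>a = Suc d\<close> by (cases "i < n") auto
    then have "ma = single j (Suc d)"
      by (intro poly_mapping_eqI) (auto simp: lookup_single when_def)
    with pure[OF j] ma show False by simp
  qed
  with a_le have a_d: "a \<le> d" by simp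
  have card: "Suc (Suc d) - a \<le> card {m\<in>slice j k. w m \<noteq> 0}" if k: "k \<in> {..a}" for k
  proof -
    have "ma \<in> slice j a" using ma by (simp add: slice_def)
    then obtain m where "m \<in> slice j k" "w m \<noteq> 0" using slice_nonzero[OF j _ ma(2)] k by auto
    then show ?thesis using card_slice_ge[OF j a_max a_le] k by auto
  qed
  \<comment> \<open>In these parameters the larger side of the inequality exceeds the smaller one by
    exactly \<open>s * r\<close>.\<close>
  obtain r where r: "d = a + r" using a_d le_Suc_ex by blast
  obtain s where s: "a = Suc s" using a1 by (cases a) auto
  have "2 * Suc d \<le> Suc a * (Suc (Suc d) - a)"
    by (simp add: r s algebra_simps)
  also have "\<dots> = (\<Sum>k\<le>a. Suc (Suc d) - a)" by simp
  also have "\<dots> \<le> (\<Sum>k\<le>a. card {m\<in>slice j k. w m \<noteq> 0})"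
    by (intro sum_mono card)
  also have "\<dots> = card (\<Union>k\<le>a. {m\<in>slice j k. w m \<noteq> 0})"
    by (rule card_UN_disjoint[symmetric]) (auto simp: slice_def)
  also have "\<dots> \<le> card ?M"
    by (rule card_mono) (auto simp: slice_def)
  finally show ?thesis .
qed

end

section \<open>The polynomial ring\<close>

lemma mpoly_ring_simps [simp]:
  "mult (mpoly_ring n) = (*)" "one (mpoly_ring n) = 1"
  "zero (mpoly_ring n) = 0" "add (mpoly_ring n) = (+)"
  by (simp_all add: mpoly_ring_def)

lemma mem_mpoly_ring: "p \<in> carrier (mpoly_ring n) \<longleftrightarrow> (\<forall>m\<in>keys p. keys m \<subseteq> {..<n})"
  by (simp add: mpoly_ring_def)

lemma keys_mult_cases:
  fixes p q :: "'a::monoid_add \<Rightarrow>\<^sub>0 'b::semiring_0"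
  assumes "m \<in> keys (p * q)"
  obtains a b where "a \<in> keys p" "b \<in> keys q" "m = a + b"
  using assms keys_mult[of p q] by blast

lemma keys_add_cases:
  fixes p q :: "'a \<Rightarrow>\<^sub>0 'b::monoid_add"
  shows "m \<in> keys (p + q) \<Longrightarrow> m \<in> keys p \<or> m \<in> keys q"
  using keys_add[of p q] by blast

lemma keys_uminus [simp]: "keys (- p) = keys (p :: 'a \<Rightarrow>\<^sub>0 'b::ab_group_add)"
  by (auto simp: in_keys_iff)

lemma keys_diff_cases:
  fixes p q :: "'a \<Rightarrow>\<^sub>0 'b::ab_group_add"
  shows "m \<in> keys (p - q) \<Longrightarrow> m \<in> keys p \<or> m \<in> keys q"
  using keys_add_cases[of m p "- q"] by simp

lemma mpoly_ring_closed [simp, intro]: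
  fixes p q :: "'k::field mpoly"
  shows "0 \<in> carrier (mpoly_ring n)" "1 \<in> carrier (mpoly_ring n)"
    and "p \<in> carrier (mpoly_ring n) \<Longrightarrow> - p \<in> carrier (mpoly_ring n)"
    and "p \<in> carrier (mpoly_ring n) \<Longrightarrow> q \<in> carrier (mpoly_ring n) \<Longrightarrow> p + q \<in> carrier (mpoly_ring n)"
    and "p \<in> carrier (mpoly_ring n) \<Longrightarrow> q \<in> carrier (mpoly_ring n) \<Longrightarrow> p * q \<in> carrier (mpoly_ring n)"
    and "keys m \<subseteq> {..<n} \<Longrightarrow> single m c \<in> carrier (mpoly_ring n)"
  by (auto simp: mem_mpoly_ring keys_add_nat dest!: keys_add_cases elim!: keys_mult_cases split: if_splits)

lemma mpoly_ring_minus_closed [simp, intro]: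
  fixes p q :: "'k::field mpoly"
  shows "p \<in> carrier (mpoly_ring n) \<Longrightarrow> q \<in> carrier (mpoly_ring n) \<Longrightarrow> p - q \<in> carrier (mpoly_ring n)"
  using mpoly_ring_closed(4)[of p n "- q"] by simp

lemma cring_mpoly_ring: "cring (mpoly_ring n :: 'k::field mpoly ring)"
proof (rule cringI)
  show "abelian_group (mpoly_ring n :: 'k mpoly ring)"
  proof (rule abelian_groupI)
    fix p :: "'k mpoly" assume "p \<in> carrier (mpoly_ring n)"
    then show "\<exists>q\<in>carrier (mpoly_ring n). q \<oplus>\<^bsub>mpoly_ring n\<^esub> p = \<zero>\<^bsub>mpoly_ring n\<^esub>"
      by (intro bexI[of _ "- p"]) auto
  qed (auto simp: algebra_simps)
  show "comm_monoid (mpoly_ring n :: 'k mpoly ring)"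
    by (rule comm_monoidI) (auto simp: algebra_simps)
qed (auto simp: algebra_simps)

lemma a_inv_mpoly_ring:
  "p \<in> carrier (mpoly_ring n) \<Longrightarrow> \<ominus>\<^bsub>mpoly_ring n\<^esub> p = - (p :: 'k::field mpoly)"
proof -
  interpret R: cring "mpoly_ring n :: 'k mpoly ring" by (rule cring_mpoly_ring)
  show "p \<in> carrier (mpoly_ring n) \<Longrightarrow> \<ominus>\<^bsub>mpoly_ring n\<^esub> p = - p"
    by (rule R.minus_equality) auto
qed

lemma mpoly_idealI:
  fixes J :: "'k::field mpoly set"
  assumes "J \<subseteq> carrier (mpoly_ring n)" "0 \<in> J" "\<And>p q. p \<in> J \<Longrightarrow> q \<in> J \<Longrightarrow> p + q \<in> J"
    and mult: "\<And>p q. p \<in> carrier (mpoly_ring n) \<Longrightarrow> q \<in> J \<Longrightarrow> p * q \<in> J"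
  shows "ideal J (mpoly_ring n)"
proof -
  interpret R: cring "mpoly_ring n :: 'k mpoly ring" by (rule cring_mpoly_ring)
  have "- p \<in> J" if "p \<in> J" for p
    using mult[of "- 1" p] that by simp
  then have "\<ominus>\<^bsub>mpoly_ring n\<^esub> p \<in> J" if "p \<in> J" for p
    using that assms(1) by (auto simp: a_inv_mpoly_ring)
  moreover have "q * p \<in> J" if "p \<in> carrier (mpoly_ring n)" "q \<in> J" for p q
    using mult[OF that] by (simp add: mult.commute)
  ultimately show ?thesis
    using assms by (intro idealI R.ring_axioms R.add.subgroupI) (auto simp: a_inv_def)
qed

section \<open>Homogeneous components and the quotient ring\<close>

lemma graded_part_carrier: "p \<in> graded_part n j \<Longrightarrow> p \<in> carrier (mpoly_ring n)"
  by (simp add: graded_part_def)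

lemma graded_part_mult:
  assumes "p \<in> graded_part n i" "q \<in> graded_part n j"
  shows "p * q \<in> graded_part n (i + j)"
  using assms by (auto simp: graded_part_def total_degree_add elim!: keys_mult_cases)

lemma graded_part_diff:
  assumes "p \<in> graded_part n j" "q \<in> graded_part n j"
  shows "p - q \<in> graded_part n j"
  using assms by (auto simp: graded_part_def dest!: keys_diff_cases)

context
  fixes n :: nat and I :: "'k::field mpoly set"
  assumes I: "ideal I (mpoly_ring n)"
begin

interpretation I: ideal I "mpoly_ring n" by (rule I)

interpretation Q: ring "mpoly_ring n Quot I" by (rule I.quotient_is_ring)

lemma mpoly_ideal_carrier: "p \<in> I \<Longrightarrow> p \<in> carrier (mpoly_ring n)"
  by (rule I.a_Hcarr)

lemma mpoly_ideal_zero: "0 \<in> I"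
  using additive_subgroup.zero_closed[OF ideal.axioms(1)[OF I]] by simp

lemma mpoly_ideal_add: "p \<in> I \<Longrightarrow> q \<in> I \<Longrightarrow> p + q \<in> I"
  using additive_subgroup.a_closed[OF ideal.axioms(1)[OF I]] by simp

lemma mpoly_ideal_mult: "p \<in> carrier (mpoly_ring n) \<Longrightarrow> q \<in> I \<Longrightarrow> p * q \<in> I"
  using I.I_l_closed by simp

lemma mpoly_ideal_uminus: "p \<in> I \<Longrightarrow> - p \<in> I"
  using mpoly_ideal_mult[of "- 1" p] by simp

lemma mpoly_ideal_diff: "p \<in> I \<Longrightarrow> q \<in> I \<Longrightarrow> p - q \<in> I"
  using mpoly_ideal_add[of p "- q"] mpoly_ideal_uminus by simp

lemma mpoly_coset_eq_iff: "I +>\<^bsub>mpoly_ring n\<^esub> p = I +>\<^bsub>mpoly_ring n\<^esub> q \<longleftrightarrow> p - q \<in> I"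
proof
  assume "I +>\<^bsub>mpoly_ring n\<^esub> p = I +>\<^bsub>mpoly_ring n\<^esub> q"
  then have "0 + p \<in> (\<lambda>h. h + q) ` I"
    using mpoly_ideal_zero by (auto simp: a_r_coset_def' )
  then show "p - q \<in> I" by auto
next
  assume pq: "p - q \<in> I"
  have "\<exists>h'\<in>I. h + p = h' + q" if "h \<in> I" for h
    using mpoly_ideal_add[OF that pq] by (intro bexI[of _ "h + (p - q)"]) auto
  moreover have "\<exists>h'\<in>I. h + q = h' + p" if "h \<in> I" for h
    using mpoly_ideal_diff[OF that pq] by (intro bexI[of _ "h - (p - q)"]) auto
  ultimately show "I +>\<^bsub>mpoly_ring n\<^esub> p = I +>\<^bsub>mpoly_ring n\<^esub> q"
    by (auto simp: a_r_coset_def')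
qed

lemma mpoly_quot_mult:
  "p \<in> carrier (mpoly_ring n) \<Longrightarrow> q \<in> carrier (mpoly_ring n) \<Longrightarrow>
   (I +>\<^bsub>mpoly_ring n\<^esub> p) \<otimes>\<^bsub>mpoly_ring n Quot I\<^esub> (I +>\<^bsub>mpoly_ring n\<^esub> q) = I +>\<^bsub>mpoly_ring n\<^esub> (p * q)"
  using I.rcoset_mult_add[of p q] by (simp add: FactRing_def)

lemma mpoly_quot_add:
  "p \<in> carrier (mpoly_ring n) \<Longrightarrow> q \<in> carrier (mpoly_ring n) \<Longrightarrow>
   (I +>\<^bsub>mpoly_ring n\<^esub> p) \<oplus>\<^bsub>mpoly_ring n Quot I\<^esub> (I +>\<^bsub>mpoly_ring n\<^esub> q) = I +>\<^bsub>mpoly_ring n\<^esub> (p + q)"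
  using I.a_rcos_sum[of p q] by (simp add: FactRing_def)

lemma carrier_mpoly_quot:
  "carrier (mpoly_ring n Quot I) = (\<lambda>p. I +>\<^bsub>mpoly_ring n\<^esub> p) ` carrier (mpoly_ring n)"
  by (auto simp: FactRing_def A_RCOSETS_def')

text \<open>Homogeneous representatives eliminate the quotient ring: injectivity becomes a kernel
  condition, and for surjectivity only one inclusion has content because \<open>l\<close> has degree
  one.\<close>

lemma weak_lefschetz_iff:
  "weak_lefschetz n I \<longleftrightarrow> (\<exists>l\<in>graded_part n 1. \<forall>j.
     (\<forall>p\<in>graded_part n j. l * p \<in> I \<longrightarrow> p \<in> I) \<or>
     (\<forall>p\<in>graded_part n (j + 1). \<exists>q\<in>graded_part n j. p - l * q \<in> I))"
proof -
  let ?c = "\<lambda>p. I +>\<^bsub>mpoly_ring n\<^esub> p"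
  have inj: "inj_on (\<lambda>x. ?c l \<otimes>\<^bsub>mpoly_ring n Quot I\<^esub> x) (quot_graded_part n I j) \<longleftrightarrow>
      (\<forall>p\<in>graded_part n j. l * p \<in> I \<longrightarrow> p \<in> I)" (is "?L \<longleftrightarrow> ?R")
    if l: "l \<in> graded_part n 1" for l j
  proof
    assume L: ?L
    show ?R
    proof safe
      fix p assume p: "p \<in> graded_part n j" "l * p \<in> I"
      have "(0 :: 'k mpoly) \<in> graded_part n j" by (simp add: graded_part_def)
      moreover have "?c l \<otimes>\<^bsub>mpoly_ring n Quot I\<^esub> ?c p = ?c l \<otimes>\<^bsub>mpoly_ring n Quot I\<^esub> ?c 0"
        using p l by (simp add: mpoly_quot_mult graded_part_carrier mpoly_coset_eq_iff)
      ultimately have "?c p = ?c 0"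
        using L p by (auto simp: inj_on_def quot_graded_part_def)
      then show "p \<in> I" by (simp add: mpoly_coset_eq_iff)
    qed
  next
    assume R: ?R
    show ?L
    proof (rule inj_onI)
      fix x y assume "x \<in> quot_graded_part n I j" "y \<in> quot_graded_part n I j"
        and eq: "?c l \<otimes>\<^bsub>mpoly_ring n Quot I\<^esub> x = ?c l \<otimes>\<^bsub>mpoly_ring n Quot I\<^esub> y"
      then obtain p q where pq: "p \<in> graded_part n j" "q \<in> graded_part n j"
        "x = ?c p" "y = ?c q" by (auto simp: quot_graded_part_def)
      then have "l * (p - q) \<in> I"
        using eq l by (simp add: mpoly_quot_mult graded_part_carrier mpoly_coset_eq_iff algebra_simps)
      then show "x = y"
        using R pq graded_part_diff[of p n j q] by (simp add: mpoly_coset_eq_iff)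
    qed
  qed
  have surj: "(\<lambda>x. ?c l \<otimes>\<^bsub>mpoly_ring n Quot I\<^esub> x) ` quot_graded_part n I j = quot_graded_part n I (j + 1) \<longleftrightarrow>
      (\<forall>p\<in>graded_part n (j + 1). \<exists>q\<in>graded_part n j. p - l * q \<in> I)"
    if l: "l \<in> graded_part n 1" for l j
  proof -
    have img: "(\<lambda>x. ?c l \<otimes>\<^bsub>mpoly_ring n Quot I\<^esub> x) ` quot_graded_part n I j =
        (\<lambda>q. ?c (l * q)) ` graded_part n j"
      unfolding quot_graded_part_def image_image
      by (intro image_cong refl mpoly_quot_mult graded_part_carrier[OF l] graded_part_carrier)
    have sub: "(\<lambda>q. ?c (l * q)) ` graded_part n j \<subseteq> quot_graded_part n I (j + 1)"
      using graded_part_mult[OF l, of _ j] by (auto simp only: quot_graded_part_def add.commute[of j])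
    have sup: "quot_graded_part n I (j + 1) \<subseteq> (\<lambda>q. ?c (l * q)) ` graded_part n j \<longleftrightarrow>
        (\<forall>p\<in>graded_part n (j + 1). \<exists>q\<in>graded_part n j. p - l * q \<in> I)"
      by (simp only: quot_graded_part_def image_subset_iff image_iff mpoly_coset_eq_iff)
    show ?thesis unfolding img set_eq_subset sup using sub by (simp only: simp_thms)
  qed
  show ?thesis
    unfolding weak_lefschetz_def quot_graded_part_def[of n I 1] bex_simps using inj surj by auto
qed

end

section \<open>Monomial ideals\<close>

text \<open>An explicit form of the monomial ideal generated by \<open>G\<close>, as
  \<open>genideal_eq_upset_ideal\<close> confirms; membership is a condition on the support
  alone.\<close>

definition upset_ideal :: "nat \<Rightarrow> (nat \<Rightarrow>\<^sub>0 nat) set \<Rightarrow> 'k::field mpoly set" where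
  "upset_ideal n G = {p \<in> carrier (mpoly_ring n). \<forall>m\<in>keys p. \<exists>g\<in>G. \<exists>u. m = g + u}"

lemma ideal_upset_ideal: "ideal (upset_ideal n G :: 'k::field mpoly set) (mpoly_ring n)"
proof (rule mpoly_idealI)
  fix p q :: "'k mpoly" assume "p \<in> upset_ideal n G" "q \<in> upset_ideal n G"
  then show "p + q \<in> upset_ideal n G"
    by (auto simp: upset_ideal_def dest!: keys_add_cases)
next
  fix p q :: "'k mpoly" assume "p \<in> carrier (mpoly_ring n)" and q: "q \<in> upset_ideal n G"
  moreover have "\<exists>g\<in>G. \<exists>u. m = g + u" if "m \<in> keys (p * q)" for m
  proof -
    obtain a b where ab: "a \<in> keys p" "b \<in> keys q" "m = a + b" using \<open>m \<in> keys (p * q)\<close> by (rule keys_mult_cases)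
    then obtain g u where "g \<in> G" "b = g + u" using q by (auto simp: upset_ideal_def)
    then have "m = g + (u + a)" using ab by (simp add: ac_simps)
    then show ?thesis using \<open>g \<in> G\<close> by blast
  qed
  ultimately show "p * q \<in> upset_ideal n G" by (simp add: upset_ideal_def)
qed (auto simp: upset_ideal_def)

lemma poly_mapping_decompose:
  fixes p :: "'a \<Rightarrow>\<^sub>0 'b::comm_monoid_add"
  shows "p = (\<Sum>m\<in>keys p. single m (lookup p m))"
proof (rule poly_mapping_eqI)
  fix k
  have "(\<Sum>m\<in>keys p. lookup p m when m = k) = (\<Sum>m\<in>keys p. if m = k then lookup p k else 0)"
    by (rule sum.cong) (auto simp: when_def)
  then show "lookup p k = lookup (\<Sum>m\<in>keys p. single m (lookup p m)) k"
    by (simp add: lookup_sum lookup_single in_keys_iff)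
qed

lemma mpoly_closure:
  fixes p :: "'a \<Rightarrow>\<^sub>0 'b::comm_monoid_add"
  assumes "0 \<in> U" "\<And>p q. p \<in> U \<Longrightarrow> q \<in> U \<Longrightarrow> p + q \<in> U"
    and "\<And>m. m \<in> keys p \<Longrightarrow> single m (lookup p m) \<in> U"
  shows "p \<in> U"
proof -
  have "(\<Sum>m\<in>A. single m (lookup p m)) \<in> U" if "finite A" "A \<subseteq> keys p" for A
    using that by (induction A rule: finite_induct) (auto intro: assms)
  from this[of "keys p"] show ?thesis by (subst poly_mapping_decompose) auto
qed

lemma genideal_eq_upset_ideal:
  assumes G: "\<And>g. g \<in> G \<Longrightarrow> keys g \<subseteq> {..<n}"
  shows "Idl\<^bsub>mpoly_ring n\<^esub> ((\<lambda>m. single m (1 :: 'k::field)) ` G) = upset_ideal n G"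
proof
  interpret R: cring "mpoly_ring n :: 'k mpoly ring" by (rule cring_mpoly_ring)
  let ?G = "(\<lambda>m. single m (1 :: 'k)) ` G"
  have sub: "?G \<subseteq> carrier (mpoly_ring n)" using G by auto
  have "\<exists>g'\<in>G. \<exists>u. g = g' + u" if "g \<in> G" for g
    using that by (intro bexI[of _ g] exI[of _ 0]) auto
  then have "?G \<subseteq> upset_ideal n G"
    using G by (auto simp: upset_ideal_def)
  then show "Idl\<^bsub>mpoly_ring n\<^esub> ?G \<subseteq> upset_ideal n G"
    by (rule R.genideal_minimal[OF ideal_upset_ideal])
  have I: "ideal (Idl\<^bsub>mpoly_ring n\<^esub> ?G) (mpoly_ring n)" by (rule R.genideal_ideal[OF sub])
  have gen: "?G \<subseteq> Idl\<^bsub>mpoly_ring n\<^esub> ?G" by (rule R.genideal_self[OF sub])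
  show "upset_ideal n G \<subseteq> Idl\<^bsub>mpoly_ring n\<^esub> ?G"
  proof
    fix p :: "'k mpoly" assume p: "p \<in> upset_ideal n G"
    show "p \<in> Idl\<^bsub>mpoly_ring n\<^esub> ?G"
    proof (rule mpoly_closure)
      fix m assume m: "m \<in> keys p"
      then obtain g u where g: "g \<in> G" "m = g + u" using p by (auto simp: upset_ideal_def)
      have "keys m \<subseteq> {..<n}" using p m by (auto simp: upset_ideal_def mem_mpoly_ring)
      then have "keys u \<subseteq> {..<n}" using g by (auto simp: keys_add_nat)
      then have "single u (lookup p m) * single g 1 \<in> Idl\<^bsub>mpoly_ring n\<^esub> ?G"
        using g gen by (intro mpoly_ideal_mult[OF I]) auto
      then show "single m (lookup p m) \<in> Idl\<^bsub>mpoly_ring n\<^esub> ?G"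
        using g by (simp add: mult_single add.commute)
    qed (use mpoly_ideal_zero[OF I] mpoly_ideal_add[OF I] in auto)
  qed
qed

lemma monomial_ideal_iff: 
  "monomial_ideal n (I :: 'k::field mpoly set) \<longleftrightarrow> (\<exists>G\<subseteq>{m. keys m \<subseteq> {..<n}}. I = upset_ideal n G)"
proof -
  have "monomials n = (\<lambda>m. single m (1 :: 'k)) ` {m. keys m \<subseteq> {..<n}}"
    by (auto simp: monomials_def)
  then have "monomial_ideal n I \<longleftrightarrow>
      (\<exists>G\<subseteq>{m. keys m \<subseteq> {..<n}}. I = Idl\<^bsub>mpoly_ring n\<^esub> ((\<lambda>m. single m (1 :: 'k)) ` G))"
    by (simp only: monomial_ideal_def subset_image_iff ex_simps) blast
  also have "\<dots> \<longleftrightarrow> (\<exists>G\<subseteq>{m. keys m \<subseteq> {..<n}}. I = upset_ideal n G)"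
    by (intro ex_cong1 conj_cong refl, subst genideal_eq_upset_ideal) auto
  finally show ?thesis .
qed

text \<open>The hypotheses give unrelated generating sets: monomials of any degree, and forms of
  degree \<open>d\<close>. Being monomial, \<open>I\<close> contains every monomial of each of these
  forms, so its monomials of degree \<open>d\<close> generate it.\<close>

lemma monomial_ideal_generated_in_degree:
  fixes I :: "'k::field mpoly set"
  assumes mon: "monomial_ideal n I" and gen: "generated_in_degree n (int d) I"
  obtains E where "E \<subseteq> mons n d" "I = upset_ideal n E"
proof
  interpret R: cring "mpoly_ring n :: 'k mpoly ring" by (rule cring_mpoly_ring)
  define E where "E = {m \<in> mons n d. single m 1 \<in> I}"
  show "E \<subseteq> mons n d" by (auto simp: E_def)
  obtain G where G: "I = upset_ideal n G" using mon by (auto simp: monomial_ideal_iff)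
  have I: "ideal I (mpoly_ring n)" unfolding G by (rule ideal_upset_ideal)
  have keys_I: "single m 1 \<in> I" if "p \<in> I" "m \<in> keys p" for p m
    using that unfolding G by (auto simp: upset_ideal_def mem_mpoly_ring)
  obtain F where F: "F \<subseteq> graded_part n (int d)" "I = Idl\<^bsub>mpoly_ring n\<^esub> F"
    using gen by (auto simp: generated_in_degree_def)
  have FI: "F \<subseteq> I"
    unfolding F(2) using F(1) by (intro R.genideal_self) (auto simp: graded_part_def)
  have "F \<subseteq> upset_ideal n E"
  proof
    fix p assume p: "p \<in> F"
    have "\<exists>g\<in>E. \<exists>u. m = g + u" if "m \<in> keys p" for m
    proof (intro bexI[of _ m] exI[of _ 0])
      have "m \<in> mons n d"
        using F(1) p that by (auto simp: mons_def graded_part_def mem_mpoly_ring)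
      then show "m \<in> E" using keys_I[of p m] p FI that by (auto simp: E_def)
    qed simp
    then show "p \<in> upset_ideal n E"
      using p F(1) by (auto simp: upset_ideal_def graded_part_def)
  qed
  then have "I \<subseteq> upset_ideal n E"
    unfolding F(2) by (rule R.genideal_minimal[OF ideal_upset_ideal])
  moreover have "upset_ideal n E \<subseteq> I"
  proof -
    have "upset_ideal n E = Idl\<^bsub>mpoly_ring n\<^esub> ((\<lambda>m. single m (1 :: 'k)) ` E)"
      by (rule genideal_eq_upset_ideal[symmetric]) (auto simp: E_def mons_def)
    also have "\<dots> \<subseteq> I" by (rule R.genideal_minimal[OF I]) (auto simp: E_def)
    finally show ?thesis .
  qed
  ultimately show "I = upset_ideal n E" by blast
qed

lemma upset_ideal_generated:
  assumes "E \<subseteq> mons n d"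
  shows "monomial_ideal n (upset_ideal n E :: 'k::field mpoly set)"
    and "generated_in_degree n (int d) (upset_ideal n E :: 'k mpoly set)"
proof -
  have eq: "upset_ideal n E = Idl\<^bsub>mpoly_ring n\<^esub> ((\<lambda>m. single m (1 :: 'k)) ` E)"
    using assms by (intro genideal_eq_upset_ideal[symmetric]) (auto simp: mons_def)
  show "monomial_ideal n (upset_ideal n E :: 'k mpoly set)"
    unfolding monomial_ideal_def eq using assms
    by (intro exI[of _ "(\<lambda>m. single m (1 :: 'k)) ` E"]) (auto simp: monomials_def mons_def)
  show "generated_in_degree n (int d) (upset_ideal n E :: 'k mpoly set)"
    unfolding generated_in_degree_def eq using assms
    by (intro exI[of _ "(\<lambda>m. single m (1 :: 'k)) ` E"])
       (auto simp: graded_part_def mons_def)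
qed

section \<open>Artinian monomial ideals\<close>

text \<open>Choose \<open>N\<close> with the smallest basis \<open>b N\<close>. A vector of
  \<open>W N\<close> outside a later \<open>W k\<close> would extend \<open>b k\<close> to an
  independent subset of \<open>W N\<close> with more than \<open>card (b N)\<close>
  elements.\<close>

lemma (in vector_space) descending_subspaces_stable:
  fixes W :: "nat \<Rightarrow> 'b set"
  assumes sub: "\<And>k. subspace (W k)" and fin: "finite B" and span: "\<And>k. W k \<subseteq> span B"
    and desc: "\<And>k. W (Suc k) \<subseteq> W k"
  obtains N where "\<And>k. k \<ge> N \<Longrightarrow> W k = W N"
proof -
  have "\<exists>b. b \<subseteq> W k \<and> independent b \<and> W k \<subseteq> span b" for k
    using maximal_independent_subset[of "W k"] by metis
  then obtain b where b: "\<And>k. b k \<subseteq> W k" "\<And>k. independent (b k)" "\<And>k. W k \<subseteq> span (b k)"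
    by metis
  have fin_b: "finite (b k)" for k
    using independent_span_bound[OF fin b(2), of k] b(1)[of k] span[of k] by auto
  obtain N where N: "\<And>k. card (b N) \<le> card (b k)"
    using ex_has_least_nat[of "\<lambda>_. True" 0 "\<lambda>k. card (b k)"] by auto
  have "W k = W N" if "k \<ge> N" for k
  proof
    show le: "W k \<subseteq> W N" using lift_Suc_antimono_le[of W, OF desc that] .
    show "W N \<subseteq> W k"
    proof
      fix v assume v: "v \<in> W N"
      show "v \<in> W k"
      proof (rule ccontr)
        assume "v \<notin> W k"
        moreover have "span (b k) \<subseteq> W k" using b(1) sub by (rule span_minimal)
        ultimately have "v \<notin> span (b k)" by blast
        then have "independent (insert v (b k))" "v \<notin> b k"
          using b(2) independent_insertI span_base by auto
        moreover have "insert v (b k) \<subseteq> span (b N)"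
          using v b(1)[of k] b(3)[of N] le by blast
        ultimately have "card (insert v (b k)) \<le> card (b N)"
          using independent_span_bound[OF fin_b] by blast
        then show False using N[of k] \<open>v \<notin> b k\<close> fin_b by simp
      qed
    qed
  qed
  then show ?thesis by (rule that)
qed

lemma vector_space_mpoly: "vector_space (\<lambda>c p :: 'k::field mpoly. single 0 c * p)"
  by unfold_locales (simp_all add: algebra_simps single_add mult_single flip: mult.assoc)

definition standard_monomials :: "nat \<Rightarrow> (nat \<Rightarrow>\<^sub>0 nat) set \<Rightarrow> (nat \<Rightarrow>\<^sub>0 nat) set" where
  "standard_monomials n E = {m. keys m \<subseteq> {..<n} \<and> (\<forall>g\<in>E. \<forall>u. m \<noteq> g + u)}"

text \<open>Here \<open>r\<close> collects the terms of \<open>p\<close> at standard monomials.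
  Keeping \<open>keys r\<close> inside \<open>keys p\<close> preserves homogeneity, which the
  Hilbert function computation uses.\<close>

lemma standard_decomposition:
  fixes p :: "'k::field mpoly"
  assumes "p \<in> carrier (mpoly_ring n)"
  obtains r where "keys r \<subseteq> standard_monomials n E \<inter> keys p" "p - r \<in> upset_ideal n E"
proof
  define r where "r = (\<Sum>m\<in>keys p \<inter> standard_monomials n E. single m (lookup p m))"
  have lookup_r: "lookup r m = (if m \<in> standard_monomials n E then lookup p m else 0)" for m
  proof -
    have "lookup r m = (\<Sum>m'\<in>keys p \<inter> standard_monomials n E. if m = m' then lookup p m else 0)"
      by (auto simp: r_def lookup_sum lookup_single when_def intro!: sum.cong)
    then show ?thesis by (simp add: in_keys_iff)
  qed
  then show "keys r \<subseteq> standard_monomials n E \<inter> keys p"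
    by (auto simp: in_keys_iff split: if_splits)
  have "keys m \<subseteq> {..<n}" "m \<notin> standard_monomials n E" if "m \<in> keys (p - r)" for m
    using that assms by (auto simp: in_keys_iff lookup_minus lookup_r mem_mpoly_ring split: if_splits)
  then show "p - r \<in> upset_ideal n E"
    by (auto simp: upset_ideal_def mem_mpoly_ring standard_monomials_def)
qed

text \<open>An exponent above \<open>d\<close> would make the monomial divisible by a pure power in
  \<open>E\<close>, so the standard monomials lie in a box.\<close>

lemma finite_standard_monomials:
  assumes "\<And>i. i < n \<Longrightarrow> single i d \<in> E"
  shows "finite (standard_monomials n E)"
proof (rule finite_subset[OF _ finite_bounded_exponents[of n d]])
  have "lookup m i \<le> d" if m: "m \<in> standard_monomials n E" for m i
  proof (rule ccontr)
    assume gt: "\<not> lookup m i \<le> d"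
    then have "i < n" using m by (auto simp: standard_monomials_def in_keys_iff subset_iff)
    moreover have "m = single i d + (m - single i d)"
      using gt by (intro poly_mapping_eqI) (auto simp: lookup_add lookup_minus lookup_single when_def)
    ultimately show False using m assms unfolding standard_monomials_def by blast
  qed
  then show "standard_monomials n E \<subseteq> {m. keys m \<subseteq> {..<n} \<and> (\<forall>i. lookup m i \<le> d)}"
    unfolding standard_monomials_def by blast
qed

text \<open>A descending chain \<open>J\<close> is pulled back to \<open>P k\<close> in the
  polynomial ring and cut down to polynomials supported on standard monomials. The resulting
  \<open>W k\<close> are subspaces of a finite-dimensional space, so they stabilize; they determine
  \<open>J k\<close> because every class has a standard representative.\<close>

lemma artinian_upset_ideal:
  assumes pure: "\<And>i. i < n \<Longrightarrow> single i d \<in> E"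
  shows "artinian_ideal n (upset_ideal n E :: 'k::field mpoly set)"
proof -
  let ?I = "upset_ideal n E :: 'k mpoly set"
  let ?Q = "mpoly_ring n Quot ?I"
  let ?c = "\<lambda>p. ?I +>\<^bsub>mpoly_ring n\<^esub> p"
  have I: "ideal ?I (mpoly_ring n)" by (rule ideal_upset_ideal)
  interpret cring "mpoly_ring n :: 'k mpoly ring" by (rule cring_mpoly_ring)
  interpret I: ideal ?I "mpoly_ring n" by (rule I)
  interpret Q: cring ?Q by (rule I.quotient_is_cring[OF cring_mpoly_ring])
  interpret V: vector_space "\<lambda>c p :: 'k mpoly. single 0 c * p" by (rule vector_space_mpoly)
  let ?B = "standard_monomials n E"
  have "\<exists>N. \<forall>k\<ge>N. J k = J N" if J: "\<And>k. ideal (J k) ?Q" "\<And>k. J (Suc k) \<subseteq> J k" for J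
  proof -
    interpret J: ideal "J k" ?Q for k by (rule J(1))
    define P where "P k = {p \<in> carrier (mpoly_ring n). ?c p \<in> J k}" for k
    have P0: "p \<in> P k" if "p \<in> ?I" for p k
    proof -
      have "?c p = ?c 0" using that by (simp add: mpoly_coset_eq_iff[OF I])
      also have "?c 0 = \<zero>\<^bsub>?Q\<^esub>"
        using I.rcos_ring_hom ring_hom_zero[OF _ ring_axioms Q.ring_axioms] by auto
      finally have "?c p = \<zero>\<^bsub>?Q\<^esub>" .
      then show ?thesis
        using J.zero_closed[of k] mpoly_ideal_carrier[OF I that] by (simp add: P_def)
    qed
    have P_add: "p + q \<in> P k" if "p \<in> P k" "q \<in> P k" for p q k
      using that J.a_closed[of "?c p" k "?c q"] by (simp add: P_def mpoly_quot_add[OF I])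
    have P_mult: "p * q \<in> P k" if "p \<in> carrier (mpoly_ring n)" "q \<in> P k" for p q k
      using that J.I_l_closed[of "?c q" k "?c p"]
      by (simp add: P_def mpoly_quot_mult[OF I] carrier_mpoly_quot[OF I])
    define W where "W k = {p \<in> P k. keys p \<subseteq> ?B}" for k
    have scale: "single 0 c * p \<in> W k" if "p \<in> W k" for c p k
      using that P_mult[of "single 0 c" p k] by (auto simp: W_def elim!: keys_mult_cases split: if_splits)
    have "V.subspace (W k)" for k
      by (rule V.subspaceI) 
        (use scale P_add P0[OF mpoly_ideal_zero[OF I]] in \<open>auto simp: W_def dest!: keys_add_cases\<close>)
    moreover have "finite ((\<lambda>m. single m (1::'k)) ` ?B)"
      using finite_standard_monomials[OF pure] by simp
    moreover have "W k \<subseteq> V.span ((\<lambda>m. single m 1) ` ?B)" for k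
    proof
      fix p assume p: "p \<in> W k"
      show "p \<in> V.span ((\<lambda>m. single m 1) ` ?B)"
      proof (rule mpoly_closure)
        fix m assume "m \<in> keys p"
        then have "single m 1 \<in> V.span ((\<lambda>m. single m (1::'k)) ` ?B)"
          using p by (intro V.span_base) (auto simp: W_def)
        from V.span_scale[OF this, of "lookup p m"]
        show "single m (lookup p m) \<in> V.span ((\<lambda>m. single m 1) ` ?B)" by (simp add: mult_single)
      qed (auto intro: V.span_zero V.span_add)
    qed
    moreover have "W (Suc k) \<subseteq> W k" for k using J(2)[of k] by (auto simp: W_def P_def)
    ultimately obtain N where N: "\<And>k. k \<ge> N \<Longrightarrow> W k = W N"
      by (rule V.descending_subspaces_stable) blast
    have "J k = J N" if k: "k \<ge> N" for k
    proof
      show "J k \<subseteq> J N" using lift_Suc_antimono_le[of J, OF J(2) k] .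
      show "J N \<subseteq> J k"
      proof
        fix x assume x: "x \<in> J N"
        then have "x \<in> carrier ?Q" by (rule J.a_Hcarr)
        then obtain p where p: "p \<in> carrier (mpoly_ring n)" "x = ?c p"
          by (auto simp: carrier_mpoly_quot[OF I])
        obtain r where r: "keys r \<subseteq> ?B \<inter> keys p" "p - r \<in> ?I"
          using standard_decomposition[OF p(1)] .
        \<comment> \<open>Only sums and multiples are known to stay in \<open>P N\<close>, so the
          subtraction is written with the multiplier -1.\<close>
        have "r = p + (- 1) * (p - r)" by simp
        also have "\<dots> \<in> P N"
          using p x by (intro P_add[OF _ P_mult[OF _ P0[OF r(2)]]]) (auto simp: P_def)
        finally have "r \<in> W k" using r N[OF k] by (auto simp: W_def)
        then have "(p - r) + r \<in> P k"
          by (intro P_add[OF P0[OF r(2)]]) (auto simp: W_def)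
        then show "x \<in> J k" using p by (simp add: P_def)
      qed
    qed
    then show ?thesis by blast
  qed
  then show ?thesis
    using I Q.cring_axioms by (auto simp: artinian_ideal_def artinian_ring_def)
qed

lemma single_add_eq_single:
  assumes "g + u = single i (N :: nat)"
  shows "g = single i (lookup g i)"
proof (rule poly_mapping_eqI)
  fix k
  have "lookup g k + lookup u k = lookup (single i N) k" by (simp flip: lookup_add add: assms)
  then show "lookup g k = lookup (single i (lookup g i)) k"
    by (cases "k = i") (auto simp: lookup_single)
qed

text \<open>The principal ideals generated by the classes of the powers of the variable
  \<open>i\<close> form a descending chain. Once it is stationary at \<open>N\<close>, some
  \<open>?x N - q * ?x (Suc N)\<close> lies in the ideal. The monomial \<open>single i N\<close>
  survives in this difference, so an element of \<open>E\<close> divides it, and that element is a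
  pure power of degree \<open>d\<close>.\<close>

lemma pure_power_if_artinian:
  assumes art: "artinian_ideal n (upset_ideal n E :: 'k::field mpoly set)"
    and E: "E \<subseteq> mons n d" and i: "i < n"
  shows "single i d \<in> E"
proof -
  let ?I = "upset_ideal n E :: 'k mpoly set"
  let ?Q = "mpoly_ring n Quot ?I"
  let ?c = "\<lambda>p. ?I +>\<^bsub>mpoly_ring n\<^esub> p"
  let ?x = "\<lambda>k. single (single i k) 1 :: 'k mpoly"
  have I: "ideal ?I (mpoly_ring n)" by (rule ideal_upset_ideal)
  interpret cring "mpoly_ring n :: 'k mpoly ring" by (rule cring_mpoly_ring)
  interpret I: ideal ?I "mpoly_ring n" by (rule I)
  interpret Q: cring ?Q by (rule I.quotient_is_cring[OF cring_mpoly_ring])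
  have x: "?x k \<in> carrier (mpoly_ring n)" for k using i by (cases "k = 0") auto
  define J where "J k = PIdl\<^bsub>?Q\<^esub> (?c (?x k))" for k
  have J: "J k = (\<lambda>q. ?c (q * ?x k)) ` carrier (mpoly_ring n)" for k
    unfolding J_def cgenideal_def using x[of k]
    by (auto simp: carrier_mpoly_quot[OF I] mpoly_quot_mult[OF I] image_iff) 
       (metis mpoly_quot_mult[OF I])+
  have "ideal (J k) ?Q" for k
    unfolding J_def by (rule Q.cgenideal_ideal) (use x in \<open>auto simp: carrier_mpoly_quot[OF I]\<close>)
  moreover have "J (Suc k) \<subseteq> J k" for k
  proof
    fix y assume "y \<in> J (Suc k)"
    then obtain q where q: "q \<in> carrier (mpoly_ring n)" "y = ?c (q * ?x (Suc k))" by (auto simp: J)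
    have "q * ?x (Suc k) = (q * ?x 1) * ?x k"
      by (simp add: mult_single mult.assoc flip: single_add)
    then have "y = ?c ((q * ?x 1) * ?x k)" using q(2) by (simp only:)
    then show "y \<in> J k"
      unfolding J using q(1) x[of 1] by (rule_tac image_eqI[of _ _ "q * ?x 1"]) auto
  qed
  ultimately obtain N where N: "\<And>k. k \<ge> N \<Longrightarrow> J k = J N"
    using art unfolding artinian_ideal_def artinian_ring_def by metis
  have "?c (?x N) \<in> J N" unfolding J by (rule image_eqI[of _ _ 1]) auto
  then have "?c (?x N) \<in> J (Suc N)" using N[of "Suc N"] by simp
  then obtain q where q: "?x N - q * ?x (Suc N) \<in> ?I"
    by (auto simp: J mpoly_coset_eq_iff[OF I])
  have "single i N \<notin> keys (q * ?x (Suc N))"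
  proof
    assume "single i N \<in> keys (q * ?x (Suc N))"
    then obtain a where "single i N = a + single i (Suc N)"
      by (auto elim!: keys_mult_cases)
    then have "lookup (single i N) i = lookup (a + single i (Suc N)) i" by simp
    then show False by (simp add: lookup_add)
  qed
  then have "single i N \<in> keys (?x N - q * ?x (Suc N))"
    by (simp add: in_keys_iff lookup_minus)
  then obtain g u where g: "g \<in> E" "single i N = g + u"
    using q unfolding upset_ideal_def by blast
  from g(2)[symmetric] have g_eq: "g = single i (lookup g i)" by (rule single_add_eq_single)
  have "total_degree g = d" using g(1) E by (auto simp: mons_def)
  then have "lookup g i = d" by (subst (asm) g_eq) simp
  then show ?thesis using g(1) g_eq by simp
qed

section \<open>The Hilbert function\<close>

lemma upset_ideal_degree_ge:
  assumes "E \<subseteq> mons n d" "p \<in> upset_ideal n E" "m \<in> keys p"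
  shows "total_degree m \<ge> d"
  using assms by (fastforce simp: upset_ideal_def total_degree_add mons_def)

lemma upset_ideal_degree_eq:
  assumes "E \<subseteq> mons n d" "p \<in> upset_ideal n E" "m \<in> keys p" "total_degree m = d"
  shows "m \<in> E"
proof -
  obtain g u where g: "g \<in> E" "m = g + u" using assms by (auto simp: upset_ideal_def)
  then have "total_degree u = 0" using assms by (auto simp: total_degree_add mons_def)
  then have "u = 0" using lookup_le_total_degree[of u] by (intro poly_mapping_eqI) simp
  then show ?thesis using g by simp
qed

lemma hilbert_function_upset_ideal:
  assumes E: "E \<subseteq> mons n d" and d: "d > 0"
  shows "hilbert_function n (upset_ideal n E :: 'k::field mpoly set) (int d) = card (mons n d - E)"
proof -
  let ?I = "upset_ideal n E :: 'k mpoly set"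
  let ?Q = "mpoly_ring n Quot ?I"
  let ?c = "\<lambda>p. ?I +>\<^bsub>mpoly_ring n\<^esub> p"
  let ?K = "quot_scalars n ?I"
  have I: "ideal ?I (mpoly_ring n)" by (rule ideal_upset_ideal)
  interpret cring "mpoly_ring n :: 'k mpoly ring" by (rule cring_mpoly_ring)
  interpret I: ideal ?I "mpoly_ring n" by (rule I)
  interpret Q: cring ?Q by (rule I.quotient_is_cring[OF cring_mpoly_ring])
  have c_carr: "?c p \<in> carrier ?Q" if "p \<in> carrier (mpoly_ring n)" for p
    using that by (auto simp: carrier_mpoly_quot[OF I])
  have c_one: "\<one>\<^bsub>?Q\<^esub> = ?c 1" by (simp add: FactRing_def)
  have c_zero: "\<zero>\<^bsub>?Q\<^esub> = ?c 0"
    using I.rcos_ring_hom ring_hom_zero[OF _ ring_axioms Q.ring_axioms] by force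
  have c_inv: "\<ominus>\<^bsub>?Q\<^esub> ?c p = ?c (- p)" if "p \<in> carrier (mpoly_ring n)" for p
    using that by (intro Q.minus_equality) (auto simp: mpoly_quot_add[OF I] c_zero c_carr)
  have scalar_carr: "single 0 c \<in> carrier (mpoly_ring n)" for c :: 'k by auto
  \<comment> \<open>Here \<open>d > 0\<close> matters: nonzero constants have degree below
    \<open>d\<close>, so the ideal is proper and the scalars embed in the quotient.\<close>
  have scalar_I: "single 0 c \<in> ?I \<longleftrightarrow> c = 0" for c
    using upset_ideal_degree_ge[OF E, of "single 0 c" 0] d mpoly_ideal_zero[OF I]
    by (cases "c = 0") (auto simp: total_degree_def)
  have K: "?K = (\<lambda>c. ?c (single 0 c)) ` UNIV" by (auto simp: quot_scalars_def)
  have "subring ?K ?Q"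
  proof (rule Q.subringI)
    fix x y assume "x \<in> ?K" "y \<in> ?K"
    then show "x \<otimes>\<^bsub>?Q\<^esub> y \<in> ?K" "x \<oplus>\<^bsub>?Q\<^esub> y \<in> ?K"
      unfolding K by (auto simp: mpoly_quot_mult[OF I] mpoly_quot_add[OF I] mult_single simp flip: single_add)
  next
    fix x assume "x \<in> ?K"
    then show "\<ominus>\<^bsub>?Q\<^esub> x \<in> ?K" unfolding K by (auto simp: c_inv simp flip: single_uminus)
  next
    show "\<one>\<^bsub>?Q\<^esub> \<in> ?K" unfolding K c_one using single_one by (metis rangeI)
  qed (auto simp: K c_carr)
  moreover have inverse: "\<exists>y\<in>?K. x \<otimes>\<^bsub>?Q\<^esub> y = \<one>\<^bsub>?Q\<^esub>" if "x \<in> ?K - {\<zero>\<^bsub>?Q\<^esub>}" for x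
  proof -
    from that obtain c where c: "x = ?c (single 0 c)" unfolding K by blast
    then have "c \<noteq> 0" using that c_zero by force
    with c have "x \<otimes>\<^bsub>?Q\<^esub> ?c (single 0 (inverse c)) = \<one>\<^bsub>?Q\<^esub>"
      by (simp add: mpoly_quot_mult[OF I] mult_single c_one)
    then show ?thesis unfolding K by (intro bexI[of _ "?c (single 0 (inverse c))"]) auto
  qed
  moreover have "\<one>\<^bsub>?Q\<^esub> \<noteq> \<zero>\<^bsub>?Q\<^esub>"
    using scalar_I[of 1] by (simp add: c_one c_zero mpoly_coset_eq_iff[OF I])
  ultimately have sf: "subfield ?K ?Q"
  proof (intro Q.subfieldI[OF Q.subcringI])
    fix x y assume "x \<in> ?K" "y \<in> ?K"
    then show "x \<otimes>\<^bsub>?Q\<^esub> y = y \<otimes>\<^bsub>?Q\<^esub> x" by (intro Q.m_comm) (auto simp: K c_carr)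
  next
    show "Units (?Q\<lparr>carrier := ?K\<rparr>) = ?K - {\<zero>\<^bsub>?Q\<^esub>}"
    proof (intro equalityI subsetI)
    fix x assume x: "x \<in> Units (?Q\<lparr>carrier := ?K\<rparr>)"
    then obtain y where y: "x \<in> ?K" "y \<in> ?K" "x \<otimes>\<^bsub>?Q\<^esub> y = \<one>\<^bsub>?Q\<^esub>"
      by (auto simp: Units_def)
    have "x \<noteq> \<zero>\<^bsub>?Q\<^esub>"
    proof
      assume "x = \<zero>\<^bsub>?Q\<^esub>"
      moreover have "y \<in> carrier ?Q" using y(2) by (auto simp: K c_carr)
      ultimately show False using y(3) \<open>\<one>\<^bsub>?Q\<^esub> \<noteq> \<zero>\<^bsub>?Q\<^esub>\<close> by simp
    qed
    then show "x \<in> ?K - {\<zero>\<^bsub>?Q\<^esub>}" using y by simp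
  next
    fix x assume x: "x \<in> ?K - {\<zero>\<^bsub>?Q\<^esub>}"
    then obtain y where y: "y \<in> ?K" "x \<otimes>\<^bsub>?Q\<^esub> y = \<one>\<^bsub>?Q\<^esub>"
      using inverse by blast
    moreover have "y \<otimes>\<^bsub>?Q\<^esub> x = x \<otimes>\<^bsub>?Q\<^esub> y"
      using x y(1) by (intro Q.m_comm) (auto simp: K c_carr)
    ultimately show "x \<in> Units (?Q\<lparr>carrier := ?K\<rparr>)"
      using x by (auto simp: Units_def)
    qed
  qed
  obtain ms where ms: "set ms = mons n d - E" "distinct ms"
    using finite_distinct_list[of "mons n d - E"] by auto
  let ?u = "\<lambda>m. ?c (single m 1)"
  have poly_carr: "p \<in> carrier (mpoly_ring n)" if "keys p \<subseteq> A" "A \<subseteq> mons n d - E"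
    for p :: "'k mpoly" and A
    using that by (auto simp: mem_mpoly_ring mons_def)
  \<comment> \<open>Proved for every sublist: the full list gives the graded component, and the
    tails are used for independence below.\<close>
  have Span: "Q.Span ?K (map ?u xs) = ?c ` {p. keys p \<subseteq> set xs}"
    if "set xs \<subseteq> mons n d - E" for xs
    using that
  proof (induction xs)
    case (Cons x xs)
    have x: "keys x \<subseteq> {..<n}" using Cons.prems by (auto simp: mons_def)
    have eq: "?c (single 0 a) \<otimes>\<^bsub>?Q\<^esub> ?u x \<oplus>\<^bsub>?Q\<^esub> ?c p = ?c (single x a + p)"
      if "keys p \<subseteq> set xs" for a p
      using poly_carr[OF that] Cons.prems x
      by (simp add: mpoly_quot_mult[OF I] mpoly_quot_add[OF I] mult_single)
    have "Q.Span ?K (map ?u (x # xs)) = Q.line_extension ?K (?u x) (?c ` {p. keys p \<subseteq> set xs})"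
      using Cons by simp
    also have "\<dots> = ?c ` {p. keys p \<subseteq> set (x # xs)}"
    proof (intro equalityI subsetI)
      fix y assume "y \<in> Q.line_extension ?K (?u x) (?c ` {p. keys p \<subseteq> set xs})"
      then obtain a p where "keys p \<subseteq> set xs" "y = ?c (single x a + p)"
        unfolding Q.line_extension_mem_iff K using eq by auto
      moreover from this have "keys (single x a + p) \<subseteq> set (x # xs)"
        by (auto dest!: keys_add_cases split: if_splits)
      ultimately show "y \<in> ?c ` {p. keys p \<subseteq> set (x # xs)}" by blast
    next
      fix y assume "y \<in> ?c ` {p. keys p \<subseteq> set (x # xs)}"
      then obtain p where p: "keys p \<subseteq> set (x # xs)" "y = ?c p" by blast
      define r where "r = p - single x (lookup p x)"
      have r: "keys r \<subseteq> set xs"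
        using p(1) by (auto simp: r_def in_keys_iff lookup_minus lookup_single when_def split: if_splits)
      have "y = ?c (single 0 (lookup p x)) \<otimes>\<^bsub>?Q\<^esub> ?u x \<oplus>\<^bsub>?Q\<^esub> ?c r"
        unfolding eq[OF r] by (simp add: r_def p)
      then show "y \<in> Q.line_extension ?K (?u x) (?c ` {p. keys p \<subseteq> set xs})"
        unfolding Q.line_extension_mem_iff K using r by blast
    qed
    finally show ?case .
  qed (simp add: c_zero)
  have ind: "Q.independent ?K (map ?u xs)" if "set xs \<subseteq> mons n d - E" "distinct xs" for xs
    using that
  proof (induction xs)
    case (Cons x xs)
    have "?u x \<notin> Q.Span ?K (map ?u xs)"
    proof
      assume "?u x \<in> Q.Span ?K (map ?u xs)"
      then obtain p where p: "keys p \<subseteq> set xs" "single x 1 - p \<in> ?I"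
        using Span[of xs] Cons.prems by (auto simp: mpoly_coset_eq_iff[OF I])
      have "x \<notin> keys p" using p(1) Cons.prems by auto
      then have "x \<in> keys (single x 1 - p)"
        by (simp add: in_keys_iff lookup_minus)
      with upset_ideal_degree_eq[OF E p(2)] Cons.prems show False by (auto simp: mons_def)
    qed
    moreover have "?u x \<in> carrier ?Q"
      using Cons.prems by (intro c_carr) (auto simp: mons_def)
    ultimately show ?case using Cons by (auto intro: Q.li_Cons)
  qed simp
  have "?c ` {p. keys p \<subseteq> mons n d - E} = quot_graded_part n ?I (int d)"
    unfolding quot_graded_part_def
  proof (intro equalityI image_subsetI)
    fix p :: "'k mpoly" assume "p \<in> {p. keys p \<subseteq> mons n d - E}"
    then have "p \<in> graded_part n (int d)"
      by (auto simp: graded_part_def mons_def mem_mpoly_ring)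
    then show "?c p \<in> ?c ` graded_part n (int d)" by blast
  next
    fix p :: "'k mpoly" assume p: "p \<in> graded_part n (int d)"
    then obtain r where r: "keys r \<subseteq> standard_monomials n E \<inter> keys p" "p - r \<in> ?I"
      using standard_decomposition[OF graded_part_carrier] by blast
    have "m \<in> mons n d - E" if "m \<in> keys r" for m
    proof -
      have "m \<noteq> g + 0" if "g \<in> E" for g
        using r(1) \<open>m \<in> keys r\<close> that unfolding standard_monomials_def by blast
      then show ?thesis
        using r(1) that p by (auto simp: graded_part_def mons_def mem_mpoly_ring)
    qed
    then show "?c p \<in> ?c ` {p. keys p \<subseteq> mons n d - E}"
      using r(2) by (intro image_eqI[of _ _ r]) (auto simp: mpoly_coset_eq_iff[OF I])
  qed
  then have "Q.dimension (length (map (\<lambda>m. ?c (single m 1)) ms)) ?K (quot_graded_part n ?I (int d))"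
    using Q.dimension_independent[OF ind[of ms]] Span[of ms] ms by (simp del: Q.Span.simps)
  then have "hilbert_function n ?I (int d) = length ms"
    using Q.dimI[OF sf] by (simp add: hilbert_function_def over_def)
  then show ?thesis using ms distinct_card by metis
qed

section \<open>The weak Lefschetz property for small Hilbert function\<close>

text \<open>Extend a basis of \<open>U\<close> by \<open>v\<close> and prescribe the values 0 and 1.
  The functional will certify that a form is not reached by multiplication with a linear
  form.\<close>

lemma separating_functional:
  fixes U :: "'k::field mpoly set"
  assumes U: "0 \<in> U" "\<And>p q. p \<in> U \<Longrightarrow> q \<in> U \<Longrightarrow> p + q \<in> U"
      "\<And>c p. p \<in> U \<Longrightarrow> single 0 c * p \<in> U" and v: "v \<notin> U"
  shows "\<exists>\<phi> :: 'k mpoly \<Rightarrow> 'k. (\<forall>p q. \<phi> (p + q) = \<phi> p + \<phi> q) \<and>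
    (\<forall>c p. \<phi> (single 0 c * p) = c * \<phi> p) \<and> (\<forall>u\<in>U. \<phi> u = 0) \<and> \<phi> v = 1"
proof -
  interpret V: vector_space "\<lambda>c p :: 'k mpoly. single 0 c * p" by (rule vector_space_mpoly)
  interpret K: vector_space "(*) :: 'k \<Rightarrow> 'k \<Rightarrow> 'k" by unfold_locales (auto simp: algebra_simps)
  interpret VK: vector_space_pair "\<lambda>c p :: 'k mpoly. single 0 c * p" "(*) :: 'k \<Rightarrow> 'k \<Rightarrow> 'k" ..
  obtain b where b: "b \<subseteq> U" "V.independent b" "U \<subseteq> V.span b"
    using V.maximal_independent_subset[of U] by metis
  have "V.subspace U" using U by (intro V.subspaceI) auto
  then have "V.span b \<subseteq> U" using b(1) by (intro V.span_minimal)
  then have vb: "v \<notin> V.span b" using v by blast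
  then have "V.independent (insert v b)" using b(2) by (rule V.independent_insertI)
  then obtain \<phi> where \<phi>: "Vector_Spaces.linear (\<lambda>c p :: 'k mpoly. single 0 c * p) (*) \<phi>"
      "\<forall>x\<in>insert v b. \<phi> x = (if x = v then 1 else 0)"
    using VK.linear_independent_extend[of "insert v b" "\<lambda>x. if x = v then 1 else 0"] by blast
  interpret \<phi>: Vector_Spaces.linear "\<lambda>c p :: 'k mpoly. single 0 c * p" "(*)" \<phi> by (rule \<phi>(1))
  have "v \<notin> b" using vb V.span_base by blast
  then have "\<phi> x = 0" if "x \<in> b" for x using \<phi>(2) that by force
  then have "\<phi> u = 0" if "u \<in> U" for u
    using \<phi>.eq_0_on_span[of b u] b(3) that by blast
  then show ?thesis
    using \<phi>.add \<phi>.scale \<phi>(2) by (intro exI[of _ \<phi>]) auto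
qed

lemma single_index_eq_iff: "c \<noteq> 0 \<Longrightarrow> single i c = single j c \<longleftrightarrow> i = j"
  by (metis lookup_single_eq lookup_single_not_eq)

text \<open>The candidate Lefschetz element; on the dual side it acts as the sum of the partial
  derivatives.\<close>

definition variable_sum :: "nat \<Rightarrow> 'k::field mpoly" where
  "variable_sum n = (\<Sum>i<n. single (single i 1) 1)"

lemma single_in_graded_part: "m \<in> mons n k \<Longrightarrow> single m c \<in> graded_part n (int k)"
  by (auto simp: graded_part_def mons_def)

lemma graded_part_zero: "0 \<in> graded_part n j"
  by (simp add: graded_part_def)

lemma graded_part_add:
  "p \<in> graded_part n j \<Longrightarrow> q \<in> graded_part n j \<Longrightarrow> p + q \<in> graded_part n j"
  by (auto simp: graded_part_def dest!: keys_add_cases)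

lemma graded_part_sum:
  "(\<And>i. i \<in> A \<Longrightarrow> f i \<in> graded_part n j) \<Longrightarrow> sum f A \<in> graded_part n j"
  by (induction A rule: infinite_finite_induct) (auto intro: graded_part_zero graded_part_add)

lemma variable_sum_graded: "variable_sum n \<in> graded_part n 1"
  unfolding variable_sum_def
  by (intro graded_part_sum) (auto simp: graded_part_def)

lemma keys_graded_part: "p \<in> graded_part n (int k) \<Longrightarrow> m \<in> keys p \<Longrightarrow> m \<in> mons n k"
  by (auto simp: graded_part_def mons_def mem_mpoly_ring)

lemma mem_upset_ideal_if_degree:
  assumes "p \<in> graded_part n (int d)" "keys p \<subseteq> E"
  shows "p \<in> upset_ideal n E"
proof -
  have "\<exists>g\<in>E. \<exists>u. m = g + u" if "m \<in> keys p" for m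
    using assms that by (intro bexI[of _ m] exI[of _ 0]) auto
  then show ?thesis using assms by (auto simp: upset_ideal_def graded_part_def)
qed

text \<open>The generators have degree \<open>d + 1\<close>, matching the index shift in
  \<open>kernel_form\<close>. If \<open>p\<close> is not reached, a functional vanishing on the
  ideal and on the image yields a nonzero \<open>w\<close> satisfying the relations of
  \<open>kernel_form\<close>. Its support avoids \<open>E\<close>, so \<open>card_support_ge\<close>
  contradicts \<open>small\<close>.\<close>

lemma surjective_if_small:
  fixes E :: "(nat \<Rightarrow>\<^sub>0 nat) set" and p :: "'k::field_char_0 mpoly"
  assumes pure: "\<And>i. i < n \<Longrightarrow> single i (Suc d) \<in> E"
    and E: "E \<subseteq> mons n (Suc d)"
    and small: "card (mons n (Suc d) - E) < 2 * Suc d"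
    and p: "p \<in> graded_part n (int (Suc d))"
  shows "\<exists>q\<in>graded_part n (int d). p - variable_sum n * q \<in> upset_ideal n E"
proof (rule ccontr)
  assume none: "\<not> ?thesis"
  let ?I = "upset_ideal n E :: 'k mpoly set"
  have I: "ideal ?I (mpoly_ring n)" by (rule ideal_upset_ideal)
  define U where "U = {p. \<exists>q\<in>graded_part n (int d). p - variable_sum n * q \<in> ?I}"
  have UI: "f \<in> U" if "q \<in> graded_part n (int d)" "f - variable_sum n * q \<in> ?I" for f q
    using that by (auto simp: U_def)
  have U0: "0 \<in> U" using graded_part_zero mpoly_ideal_zero[OF I] by (intro UI[of 0]) auto
  have U_add: "f + g \<in> U" if "f \<in> U" "g \<in> U" for f g
  proof -
    obtain q where q: "q \<in> graded_part n (int d)" "f - variable_sum n * q \<in> ?I"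
      using \<open>f \<in> U\<close> by (auto simp: U_def)
    obtain r where r: "r \<in> graded_part n (int d)" "g - variable_sum n * r \<in> ?I"
      using \<open>g \<in> U\<close> by (auto simp: U_def)
    note qr = q r
    have "(f - variable_sum n * q) + (g - variable_sum n * r) \<in> ?I"
      using qr by (intro mpoly_ideal_add[OF I])
    then show ?thesis
      using qr by (intro UI[of "q + r"] graded_part_add) (simp_all add: algebra_simps)
  qed
  have U_scale: "single 0 c * f \<in> U" if "f \<in> U" for c f
  proof -
    obtain q where q: "q \<in> graded_part n (int d)" "f - variable_sum n * q \<in> ?I"
      using \<open>f \<in> U\<close> by (auto simp: U_def)
    have "single 0 c * (f - variable_sum n * q) \<in> ?I"
      using q by (intro mpoly_ideal_mult[OF I]) auto
    moreover have "single 0 c * q \<in> graded_part n (int d)"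
      using graded_part_mult[OF single_in_graded_part[of 0 n 0] q(1)] by (simp add: mons_def total_degree_def)
    ultimately show ?thesis
      by (intro UI[of "single 0 c * q"]) (simp_all add: algebra_simps)
  qed
  have pU: "p \<notin> U" using none by (auto simp: U_def)
  obtain \<phi> :: "'k mpoly \<Rightarrow> 'k" where \<phi>: "\<And>f g. \<phi> (f + g) = \<phi> f + \<phi> g"
    "\<And>c f. \<phi> (single 0 c * f) = c * \<phi> f" "\<And>u. u \<in> U \<Longrightarrow> \<phi> u = 0" "\<phi> p = 1"
    using separating_functional[OF U0 U_add U_scale pU] by metis
  have \<phi>_0: "\<phi> 0 = 0" using \<phi>(1)[of 0 0] by simp
  have \<phi>_sum: "\<phi> (sum f A) = (\<Sum>i\<in>A. \<phi> (f i))" for f and A :: "nat set"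
    by (induction A rule: infinite_finite_induct) (auto simp: \<phi>_0 \<phi>)
  \<comment> \<open>dividing by factorials turns the contraction action of the variables into differentiation\<close>
  define fct where "fct m = (\<Prod>i<n. fact (lookup m i) :: 'k)" for m
  have fct0: "fct m \<noteq> 0" for m by (simp add: fct_def)
  have fct_add: "fct (m + single i 1) = of_nat (Suc (lookup m i)) * fct m" if "i < n" for m i
  proof -
    have split: "fct m' = fact (lookup m' i) * (\<Prod>j\<in>{..<n} - {i}. fact (lookup m' j))" for m'
      unfolding fct_def using that by (subst prod.remove[of _ i]) auto
    have "(\<Prod>j\<in>{..<n} - {i}. fact (lookup (m + single i 1) j) :: 'k) =
        (\<Prod>j\<in>{..<n} - {i}. fact (lookup m j))"
      by (intro prod.cong) (auto simp: lookup_add lookup_single)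
    then show ?thesis unfolding split[of m] split[of "m + single i 1"] by (simp add: lookup_add)
  qed
  define w where "w m = \<phi> (single m 1) / fct m" for m
  \<comment> \<open>The relation at \<open>m\<close> is the vanishing of \<open>\<phi>\<close> on
    \<open>variable_sum n * single m 1\<close>, divided by \<open>fct m\<close>.\<close>
  interpret kernel_form n d w
  proof
    fix m assume m: "m \<in> mons n d"
    have "variable_sum n * single m 1 \<in> U"
      using m mpoly_ideal_zero[OF I] by (intro UI[of "single m 1"] single_in_graded_part) auto
    then have "0 = \<phi> (variable_sum n * single m 1)" using \<phi>(3) by simp
    also have "variable_sum n * single m 1 = (\<Sum>i<n. single (m + single i 1) (1 :: 'k))"
      by (simp add: variable_sum_def sum_distrib_right mult_single add.commute)
    also have "\<phi> \<dots> = (\<Sum>i<n. fct m * (of_nat (Suc (lookup m i)) * w (m + single i 1)))"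
      unfolding \<phi>_sum using fct0[of m]
      by (intro sum.cong refl) (simp add: w_def fct_add[unfolded One_nat_def] del: of_nat_Suc)
    finally show "(\<Sum>i<n. of_nat (Suc (lookup m i)) * w (m + single i 1)) = 0"
      using fct0[of m] by (simp flip: sum_distrib_left del: of_nat_Suc)
  qed
  have w_E: "w m = 0" if "m \<in> E" for m
  proof -
    have "single m 1 \<in> ?I"
      using that E by (intro mem_upset_ideal_if_degree[OF single_in_graded_part]) auto
    then have "single m 1 \<in> U" using graded_part_zero by (intro UI[of 0]) auto
    then show ?thesis using \<phi>(3) by (simp add: w_def)
  qed
  \<comment> \<open>Otherwise \<open>\<phi>\<close> would vanish on every term of \<open>p\<close>,
    against \<open>\<phi> p = 1\<close>.\<close>
  have "\<exists>m\<in>mons n (Suc d). w m \<noteq> 0"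
  proof (rule ccontr)
    assume zero: "\<not> ?thesis"
    have "p \<in> {f. \<phi> f = 0}"
    proof (rule mpoly_closure)
      fix m assume "m \<in> keys p"
      then have "m \<in> mons n (Suc d)" by (rule keys_graded_part[OF p])
      then have "\<phi> (single m 1) = 0" using zero fct0[of m] by (auto simp: w_def)
      then show "single m (lookup p m) \<in> {f. \<phi> f = 0}"
        using \<phi>(2)[of "lookup p m" "single m 1"] by (simp add: mult_single)
    qed (auto simp: \<phi>_0 \<phi>)
    then show False using \<phi>(4) by simp
  qed
  then obtain m0 where m0: "m0 \<in> mons n (Suc d)" "w m0 \<noteq> 0" by blast
  have "2 * Suc d \<le> card {m \<in> mons n (Suc d). w m \<noteq> 0}"
    using w_E pure by (intro card_support_ge[OF _ m0]) auto
  also have "\<dots> \<le> card (mons n (Suc d) - E)"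
    using w_E by (intro card_mono) auto
  finally show False using small by simp
qed

lemma mons_split:
  assumes "m \<in> mons n (k + r)"
  obtains m' u where "m = m' + u" "m' \<in> mons n k" "u \<in> mons n r"
  using assms
proof (induction r arbitrary: m thesis)
  case 0
  show ?case by (rule 0(1)[of m 0]) (use 0 in \<open>auto simp: mons_def total_degree_def\<close>)
next
  case (Suc r)
  have "\<exists>i. lookup m i \<noteq> 0" using mons_total[OF Suc.prems(2)] by (metis add_Suc_right nat.distinct(1) sum.neutral)
  then obtain i where "lookup m i \<noteq> 0" ..
  moreover have "m \<in> mons n (Suc (k + r))" using Suc.prems(2) by simp
  ultimately obtain m1 where m1: "m = m1 + single i 1" "m1 \<in> mons n (k + r)" "i < n"
    by (metis mons_Suc_cases)
  obtain m' u where "m1 = m' + u" "m' \<in> mons n k" "u \<in> mons n r" using Suc.IH m1(2) by blast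
  then show ?case
    using m1 mons_add_single[of u n r i] by (intro Suc.prems(1)[of m' "u + single i 1"]) (auto simp: ac_simps)
qed

text \<open>Every monomial of degree \<open>d + 1 + r\<close> is a product of monomials of degrees
  \<open>d + 1\<close> and \<open>r\<close>; multiplying a preimage of the first factor by the
  second factor gives a preimage of the product.\<close>

lemma surjective_above:
  fixes l :: "'k::field mpoly"
  assumes I: "ideal I (mpoly_ring n)"
    and surj: "\<And>p. p \<in> graded_part n (int (Suc d)) \<Longrightarrow> \<exists>q\<in>graded_part n (int d). p - l * q \<in> I"
    and p: "p \<in> graded_part n (int (Suc d + r))"
  shows "\<exists>q\<in>graded_part n (int (d + r)). p - l * q \<in> I"
proof -
  have "p \<in> {f. \<exists>q\<in>graded_part n (int (d + r)). f - l * q \<in> I}"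
  proof (rule mpoly_closure)
    show "0 \<in> {f. \<exists>q\<in>graded_part n (int (d + r)). f - l * q \<in> I}"
      using graded_part_zero mpoly_ideal_zero[OF I] by (auto intro!: bexI[of _ 0])
  next
    fix f g assume "f \<in> {f. \<exists>q\<in>graded_part n (int (d + r)). f - l * q \<in> I}"
      "g \<in> {f. \<exists>q\<in>graded_part n (int (d + r)). f - l * q \<in> I}"
    then obtain q q' where q: "q \<in> graded_part n (int (d + r))" "f - l * q \<in> I"
      "q' \<in> graded_part n (int (d + r))" "g - l * q' \<in> I" by auto
    have "f + g - l * (q + q') = (f - l * q) + (g - l * q')" by (simp add: algebra_simps)
    then have "f + g - l * (q + q') \<in> I" using mpoly_ideal_add[OF I q(2,4)] by (simp only:)
    then show "f + g \<in> {f. \<exists>q\<in>graded_part n (int (d + r)). f - l * q \<in> I}"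
      using graded_part_add[OF q(1,3)] by blast
  next
    fix m assume "m \<in> keys p"
    then have "m \<in> mons n (Suc d + r)" by (rule keys_graded_part[OF p])
    then obtain m' u where m: "m = m' + u" "m' \<in> mons n (Suc d)" "u \<in> mons n r"
      by (rule mons_split)
    define c where "c = lookup p m"
    obtain q where q: "q \<in> graded_part n (int d)" "single m' 1 - l * q \<in> I"
      using surj[OF single_in_graded_part[OF m(2), of 1]] by auto
    have "single u c * (single m' 1 - l * q) \<in> I"
      using m q by (intro mpoly_ideal_mult[OF I]) (auto simp: mons_def)
    moreover have "single u c * (single m' 1 - l * q) = single m c - l * (single u c * q)"
      by (simp add: right_diff_distrib mult_single m(1) add.commute mult.left_commute)
    moreover have "single u c * q \<in> graded_part n (int (d + r))"
      using graded_part_mult[OF single_in_graded_part[OF m(3)] q(1)] by (simp add: add.commute)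
    ultimately show "single m (lookup p m) \<in> {f. \<exists>q\<in>graded_part n (int (d + r)). f - l * q \<in> I}"
      unfolding c_def[symmetric] by auto
  qed
  then show ?thesis by simp
qed

text \<open>The cases split at \<open>j = d - 1\<close>. Below it, negative \<open>j\<close>
  included, \<open>?l * p\<close> has degree less than \<open>d\<close>, where the ideal is zero,
  and there are no zero divisors. From there on surjectivity propagates upwards.\<close>

theorem weak_lefschetz_if_small:
  assumes pure: "\<And>i. i < n \<Longrightarrow> single i d \<in> E"
    and E: "E \<subseteq> mons n d" and d: "d > 0" and n: "n > 0"
    and small: "card (mons n d - E) < 2 * d"
  shows "weak_lefschetz n (upset_ideal n E :: 'k::field_char_0 mpoly set)"
proof -
  let ?I = "upset_ideal n E :: 'k mpoly set" and ?l = "variable_sum n :: 'k mpoly"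
  have I: "ideal ?I (mpoly_ring n)" by (rule ideal_upset_ideal)
  obtain e where e: "d = Suc e" using d by (cases d) auto
  have inj_single: "single (i :: nat) (1 :: nat) = single 0 1 \<longleftrightarrow> i = 0" for i
    by (simp add: single_index_eq_iff)
  have "lookup ?l (single 0 1) = (\<Sum>i<n. if i = 0 then 1 else 0)"
    unfolding variable_sum_def lookup_sum lookup_single inj_single when_def ..
  then have l0: "?l \<noteq> 0" using n by auto
  have "(\<forall>p\<in>graded_part n j. ?l * p \<in> ?I \<longrightarrow> p \<in> ?I) \<or>
     (\<forall>p\<in>graded_part n (j + 1). \<exists>q\<in>graded_part n j. p - ?l * q \<in> ?I)" for j
  proof (cases "j < int e")
    case True
    have "p \<in> ?I" if p: "p \<in> graded_part n j" "?l * p \<in> ?I" for p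
    proof (cases "p = 0")
      case False
      with l0 have "?l * p \<noteq> 0" by simp
      then obtain m where m: "m \<in> keys (?l * p)" by (metis keys_eq_empty all_not_in_conv)
      have "int (total_degree m) = 1 + j"
        using graded_part_mult[OF variable_sum_graded p(1)] m by (simp add: graded_part_def)
      moreover have "d \<le> total_degree m" by (rule upset_ideal_degree_ge[OF E p(2) m])
      ultimately show ?thesis using True e by simp
    qed (use mpoly_ideal_zero[OF I] in simp)
    then show ?thesis by blast
  next
    case False
    then obtain r where r: "j = int (e + r)"
      by (metis not_less nat_eq_iff2 le_Suc_ex of_nat_0_le_iff order_trans nat_int int_nat_eq zle_int zero_le_imp_eq_int)
    then have "j + 1 = int (Suc e + r)" by simp
    then show ?thesis
      using surjective_above[OF I surjective_if_small[OF pure[unfolded e] E[unfolded e] small[unfolded e]], of _ r] r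
      by metis
  qed
  then show ?thesis
    unfolding weak_lefschetz_iff[OF I] using variable_sum_graded by blast
qed

section \<open>An extremal ideal\<close>

text \<open>The monomials of \<open>(x_1 - x_2) (x_3 - x_4)^e\<close>, a form of degree
  \<open>e + 1\<close>, which plays the role of \<open>d\<close>. For \<open>n > 4\<close> the total
  degree rules out further variables.\<close>

definition extremal_support :: "nat \<Rightarrow> nat \<Rightarrow> (nat \<Rightarrow>\<^sub>0 nat) set" where
  "extremal_support n e =
     {m \<in> mons n (Suc e). lookup m 0 + lookup m 1 = 1 \<and> lookup m 2 + lookup m 3 = e}"

lemma extremal_support_eq_image:
  assumes n: "n \<ge> 4"
  shows "extremal_support n e =
    (\<lambda>(i, a). single i 1 + single 2 a + single 3 (e - a)) ` ({0, 1} \<times> {..e})" (is "_ = ?f ` _")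
proof (intro equalityI subsetI)
  fix m assume "m \<in> ?f ` ({0, 1} \<times> {..e})"
  then obtain i a where m: "m = single i 1 + single 2 a + single 3 (e - a)" "i \<in> {0, 1}" "a \<le> e"
    by auto
  have "i < n" using m n by auto
  moreover have "total_degree m = Suc e" using m(3) by (simp add: m(1) total_degree_add)
  ultimately have "m \<in> mons n (Suc e)"
    using n by (auto simp: mons_def m(1) keys_add_nat)
  then show "m \<in> extremal_support n e"
    using m(2,3) by (auto simp: extremal_support_def m(1) lookup_add lookup_single when_def)
next
  fix m assume m: "m \<in> extremal_support n e"
  then have lk: "lookup m 0 + lookup m 1 = 1" "lookup m 2 + lookup m 3 = e" and mm: "m \<in> mons n (Suc e)"
    by (auto simp: extremal_support_def)
  \<comment> \<open>The first four exponents already exhaust the total degree, so all others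
    vanish.\<close>
  have "(\<Sum>k<n. lookup m k) = (\<Sum>k\<in>{0, 1, 2, 3}. lookup m k) + (\<Sum>k\<in>{..<n} - {0, 1, 2, 3}. lookup m k)"
    using n by (subst sum.subset_diff[of "{0, 1, 2, 3}"]) auto
  moreover have "(\<Sum>k\<in>{0, 1, 2, 3}. lookup m k) = Suc e" using lk by simp
  ultimately have "(\<Sum>k\<in>{..<n} - {0, 1, 2, 3}. lookup m k) = 0"
    using mons_total[OF mm] by linarith
  then have rest: "lookup m k = 0" if "k \<notin> {0, 1, 2, 3}" for k
    using that mons_lookup_ge[OF mm, of k] by (cases "k < n") auto
  obtain i where i: "i \<in> {0, 1}" "lookup m i = 1" "\<And>k. k \<in> {0, 1} \<Longrightarrow> k \<noteq> i \<Longrightarrow> lookup m k = 0"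
    using lk(1) by (cases "lookup m 0") auto
  have "lookup m k = lookup (?f (i, lookup m 2)) k" for k
  proof -
    have f: "lookup (?f (i, lookup m 2)) k = (if k = i then 1 else 0) +
        (if k = 2 then lookup m 2 else 0) + (if k = 3 then e - lookup m 2 else 0)"
      by (simp add: lookup_add lookup_single when_def)
    consider "k = i" | "k \<in> {0, 1}" "k \<noteq> i" | "k = 2" | "k = 3" | "k \<notin> {0, 1, 2, 3}" by blast
    then show ?thesis
    proof cases
      case 2
      then show ?thesis unfolding f using i(3)[of k] by force
    next
      case 5
      then have "k \<noteq> i" using i(1) by blast
      then show ?thesis unfolding f using rest[OF 5] 5 by simp
    qed (use i(1,2) lk(2) f in auto)
  qed
  then have "m = ?f (i, lookup m 2)" by (rule poly_mapping_eqI)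
  then show "m \<in> ?f ` ({0, 1} \<times> {..e})"
    using i(1) lk(2) by (intro image_eqI[of _ _ "(i, lookup m 2)"]) auto
qed

lemma card_extremal_support:
  assumes n: "n \<ge> 4"
  shows "card (extremal_support n e) = 2 * Suc e"
proof -
  let ?f = "\<lambda>(i :: nat, a). single i 1 + single 2 a + single 3 (e - a) :: nat \<Rightarrow>\<^sub>0 nat"
  have "inj_on ?f ({0, 1} \<times> {..e})"
  proof (rule inj_onI, clarify)
    fix i a i' a'
    assume i: "i \<in> {0, 1 :: nat}" "i' \<in> {0, 1 :: nat}"
      and eq: "single i 1 + single 2 a + single 3 (e - a) =
         (single i' 1 + single 2 a' + single 3 (e - a') :: nat \<Rightarrow>\<^sub>0 nat)"
    have "lookup (single i 1 + single 2 a + single 3 (e - a)) k =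
        lookup (single i' 1 + single 2 a' + single 3 (e - a')) k" for k :: nat
      by (simp only: eq)
    from this[of 0] this[of 2] show "i = i' \<and> a = a'"
      using i by (auto simp: lookup_add lookup_single when_def)
  qed
  then show ?thesis
    by (subst extremal_support_eq_image[OF n], subst card_image) auto
qed

definition extremal_generators :: "nat \<Rightarrow> nat \<Rightarrow> (nat \<Rightarrow>\<^sub>0 nat) set" where
  "extremal_generators n e = mons n (Suc e) - extremal_support n e"

lemma extremal_generators_subset: "extremal_generators n e \<subseteq> mons n (Suc e)"
  by (auto simp: extremal_generators_def)

lemma mons_diff_extremal_generators: "mons n (Suc e) - extremal_generators n e = extremal_support n e"
  by (auto simp: extremal_generators_def extremal_support_def)

text \<open>For \<open>e = 0\<close> the first variable itself would lie in the support; with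
  \<open>e \<ge> 1\<close> all pure powers are generators, which makes the ideal artinian.\<close>

lemma pure_power_extremal:
  assumes "e \<ge> 1" "i < n"
  shows "single i (Suc e) \<in> extremal_generators n e"
  using assms by (auto simp: extremal_generators_def extremal_support_def mons_def lookup_single when_def
      split: if_splits)

section \<open>Failure of injectivity and surjectivity for the extremal ideal\<close>

lemma linear_form_eq:
  assumes "l \<in> graded_part n 1"
  shows "l = (\<Sum>i<n. single (single i 1) (lookup l (single i 1)))"
proof -
  have mons1: "mons n 1 = (\<lambda>i. single i 1) ` {..<n}"
  proof (intro equalityI subsetI)
    fix m assume m: "m \<in> mons n 1"
    then obtain i where i: "lookup m i \<noteq> 0"
      using mons_total[OF m] by (metis sum.neutral zero_neq_one)
    with m obtain m' where m': "m = m' + single i 1" "m' \<in> mons n 0" "i < n"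
      by (metis One_nat_def mons_Suc_cases)
    have "lookup m' k = 0" for k using lookup_le_total_degree[of m' k] m'(2) by (simp add: mons_def)
    then have "m' = 0" by (intro poly_mapping_eqI) simp
    then show "m \<in> (\<lambda>i. single i 1) ` {..<n}" using m' by auto
  qed (auto simp: mons_def)
  have "l = (\<Sum>m\<in>keys l. single m (lookup l m))" by (rule poly_mapping_decompose)
  also have "\<dots> = (\<Sum>m\<in>mons n 1. single m (lookup l m))"
    using keys_graded_part[of l n 1] assms
    by (intro sum.mono_neutral_left) (auto simp: in_keys_iff)
  also have "\<dots> = (\<Sum>i<n. single (single i 1) (lookup l (single i 1)))"
    unfolding mons1
    by (subst sum.reindex) (auto simp: inj_on_def dest!: arg_cong[of _ _ keys])
  finally show ?thesis .
qed

text \<open>The ideal is zero in degree \<open>e\<close>, so any nonzero \<open>p\<close> works for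
  which \<open>l * p\<close> has no monomial in the support. For \<open>e \<ge> 2\<close> take
  \<open>x_1^e\<close>, since support monomials contain \<open>x_1\<close> at most once. For
  \<open>e = 1\<close> the support consists of products of one of \<open>x_1\<close>,
  \<open>x_2\<close> with one of \<open>x_3\<close>, \<open>x_4\<close>, and \<open>p\<close> is
  chosen to cancel these.\<close>

lemma extremal_not_injective:
  fixes l :: "'k::field mpoly"
  assumes n: "n \<ge> 4" and e: "e \<ge> 1" and l: "l \<in> graded_part n 1"
  shows "\<exists>p\<in>graded_part n (int e). l * p \<in> upset_ideal n (extremal_generators n e) \<and>
            p \<notin> upset_ideal n (extremal_generators n e)"
proof -
  let ?E = "extremal_generators n e"
  let ?x = "\<lambda>i. single (single i 1) 1 :: 'k mpoly"
  have suff: ?thesis if p: "p \<in> graded_part n (int e)" "p \<noteq> 0"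
    and keys: "\<And>m. m \<in> keys (l * p) \<Longrightarrow> m \<notin> extremal_support n e" for p
  proof (rule bexI[of _ p], rule conjI)
    have lp: "l * p \<in> graded_part n (int (Suc e))"
      using graded_part_mult[OF l p(1)] by simp
    moreover have "keys (l * p) \<subseteq> ?E"
      using keys keys_graded_part[OF lp] by (auto simp: extremal_generators_def)
    ultimately show "l * p \<in> upset_ideal n ?E" by (rule mem_upset_ideal_if_degree)
    show "p \<notin> upset_ideal n ?E"
    proof
      assume I: "p \<in> upset_ideal n ?E"
      obtain m where m: "m \<in> keys p" using p(2) by (metis keys_eq_empty all_not_in_conv)
      then have "total_degree m = e" using keys_graded_part[OF p(1)] by (simp add: mons_def)
      then show False using upset_ideal_degree_ge[OF extremal_generators_subset I m] by simp
    qed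
  qed (rule p(1))
  show ?thesis
  proof (cases "e = 1")
    case False
    show ?thesis
    proof (rule suff)
      show "single (single 0 e) (1 :: 'k) \<in> graded_part n (int e)"
        using n by (intro single_in_graded_part) (auto simp: mons_def)
      fix m assume "m \<in> keys (l * single (single 0 e) 1)"
      then obtain s where "m = s + single 0 e" by (auto elim!: keys_mult_cases)
      then show "m \<notin> extremal_support n e" using e False by (auto simp: extremal_support_def lookup_add)
    qed (metis single_zero inj_single injD zero_neq_one lookup_single_eq lookup_zero)
  next
    case e1: True
    define a where "a i = lookup l (single i 1)" for i
    define f where "f S = (\<Sum>i\<in>S. single (single i (1 :: nat)) (a i))" for S
    define A where "A = f {0, 1}"
    define B where "B = f {2, 3}"
    define C where "C = f ({..<n} - {0, 1, 2, 3})"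
    have "l = f {..<n}" using linear_form_eq[OF l] by (simp add: f_def a_def)
    also have "{..<n} = {0, 1} \<union> ({2, 3} \<union> ({..<n} - {0, 1, 2, 3}))" using n by auto
    also have "f \<dots> = A + (B + C)"
      unfolding A_def B_def C_def f_def by (subst sum.union_disjoint, simp, simp, force)+ simp
    finally have l_eq: "l = A + (B + C)" .
    have keys_f: "\<exists>i\<in>S. m = single i 1" if "m \<in> keys (f S)" "finite S" for m S
    proof -
      have "m \<in> (\<Union>i\<in>S. keys (single (single i 1) (a i)))"
        by (rule subsetD[OF keys_sum that(1)[unfolded f_def]])
      then obtain i where "i \<in> S" "m \<in> keys (single (single i 1) (a i))" by blast
      then show ?thesis by (intro bexI[of _ i]) (simp_all split: if_splits)
    qed
    have f_graded: "f S \<in> graded_part n (int e)" if "S \<subseteq> {..<n}" for S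
      unfolding f_def e1 using that by (intro graded_part_sum) (auto simp: graded_part_def)
    have notin: "single i 1 + single j 1 \<notin> extremal_support n e"
      if "i \<in> {0, 1} \<and> j \<in> {0, 1} \<or> i \<in> {2, 3} \<and> j \<in> {2, 3} \<or> i \<notin> {0, 1, 2, 3}" for i j
      using that by (auto simp: extremal_support_def e1 lookup_add lookup_single when_def)
    have notin_mult: "m \<notin> extremal_support n e"
      if "m \<in> keys (f S * f T)" "finite S" "finite T"
        "S \<subseteq> {0, 1} \<and> T \<subseteq> {0, 1} \<or> S \<subseteq> {2, 3} \<and> T \<subseteq> {2, 3} \<or> S \<inter> {0, 1, 2, 3} = {}" for m S T
    proof -
      note asm = that
      obtain s t where st: "s \<in> keys (f S)" "t \<in> keys (f T)" "m = s + t"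
        using asm(1) by (rule keys_mult_cases)
      obtain i where "i \<in> S" "s = single i 1" using keys_f[OF st(1) asm(2)] by blast
      moreover obtain j where "j \<in> T" "t = single j 1" using keys_f[OF st(2) asm(3)] by blast
      ultimately have "m = single i 1 + single j 1" "i \<in> S" "j \<in> T" using st(3) by simp_all
      moreover have "i \<in> {0, 1} \<and> j \<in> {0, 1} \<or> i \<in> {2, 3} \<and> j \<in> {2, 3} \<or> i \<notin> {0, 1, 2, 3}"
        using asm(4) calculation(2,3)
        by (elim disjE) (simp_all add: subset_iff disjoint_iff del: insert_iff)
      ultimately show ?thesis using notin[of i j] by simp
    qed
    show ?thesis
    proof (cases "A - B = 0")
      case False
      show ?thesis
      proof (rule suff)
        show "A - B \<in> graded_part n (int e)"
          unfolding A_def B_def using n by (intro graded_part_diff f_graded) auto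
        fix m assume "m \<in> keys (l * (A - B))"
        \<comment> \<open>The mixed products of \<open>A\<close> and \<open>B\<close> cancel;
          squares and multiples of \<open>C\<close> have no monomials in the support.\<close>
        also have "l * (A - B) = (A * A + C * A) - (B * B + C * B)"
          by (simp add: l_eq algebra_simps)
        finally have "m \<in> keys (A * A) \<or> m \<in> keys (C * A) \<or> m \<in> keys (B * B) \<or> m \<in> keys (C * B)"
          by (blast dest!: keys_add_cases keys_diff_cases)
        then show "m \<notin> extremal_support n e"
          unfolding A_def B_def C_def by (elim disjE; elim notin_mult) auto
      qed (rule False)
    next
      case True
      \<comment> \<open>\<open>A\<close> and \<open>B\<close> involve different variables, so
        \<open>A = B\<close> forces both to vanish. Then \<open>l = C\<close>, and
        \<open>x_1\<close> serves as \<open>p\<close>.\<close>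
      have "lookup (A - B) (single i 1) = 0" for i using True by simp
      from this[of 0] this[of 1] this[of 2] this[of 3] have a0: "a 0 = 0 \<and> a 1 = 0 \<and> a 2 = 0 \<and> a 3 = 0"
        by (simp add: A_def B_def f_def lookup_minus lookup_add lookup_single when_def
            single_index_eq_iff)
      then have "l = C" by (simp add: l_eq A_def B_def f_def)
      show ?thesis
      proof (rule suff)
        show "?x 0 \<in> graded_part n (int e)"
          using n by (intro single_in_graded_part) (auto simp: mons_def e1)
        fix m assume "m \<in> keys (l * ?x 0)"
        then obtain s where s: "s \<in> keys (f ({..<n} - {0, 1, 2, 3}))" "m = s + single 0 1"
          unfolding \<open>l = C\<close> C_def by (elim keys_mult_cases) simp
        obtain i where "i \<in> {..<n} - {0, 1, 2, 3}" "s = single i 1"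
          using keys_f[OF s(1)] by blast
        then show "m \<notin> extremal_support n e" using notin[of i 0] s(2) by simp
      qed (metis lookup_single_eq lookup_zero zero_neq_one)
    qed
  qed
qed

text \<open>By duality it suffices to find, for the given \<open>l\<close>, a functional
  \<open>\<phi>\<close> on degree \<open>e + 1\<close> that kills the ideal and all products
  \<open>l * q\<close> without being zero.\<close>

lemma extremal_not_surjective:
  fixes l :: "'k::field mpoly"
  assumes n: "n \<ge> 4" and e: "e \<ge> 1" and l: "l \<in> graded_part n 1"
  shows "\<exists>p\<in>graded_part n (int e + 1). \<forall>q\<in>graded_part n (int e).
            p - l * q \<notin> upset_ideal n (extremal_generators n e)"
proof -
  let ?E = "extremal_generators n e" and ?B = "extremal_support n e"
  define a where "a i = lookup l (single i 1)" for i
  \<comment> \<open>Provides, for each pair of variables, a nonzero linear form whose pairing with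
    \<open>l\<close> is zero.\<close>
  have ex: "\<exists>y z. (y \<noteq> 0 \<or> z \<noteq> 0) \<and> a i * y + a j * z = 0" for i j
  proof (cases "a i = 0")
    case True
    then show ?thesis by (intro exI[of _ 1] exI[of _ 0]) simp
  next
    case False
    then show ?thesis by (intro exI[of _ "- a j"] exI[of _ "a i"]) simp
  qed
  obtain b0 b1 where b01: "b0 \<noteq> 0 \<or> b1 \<noteq> 0" "a 0 * b0 + a 1 * b1 = 0" using ex by blast
  obtain b2 b3 where b23: "b2 \<noteq> 0 \<or> b3 \<noteq> 0" "a 2 * b2 + a 3 * b3 = 0" using ex by blast
  \<comment> \<open>the divided power coefficients of \<open>(b0 x\<^sub>1 + b1 x\<^sub>2) (b2 x\<^sub>3 + b3 x\<^sub>4)\<^sup>e\<close>, a form killed by \<open>l\<close>\<close>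
  define \<psi> where "\<psi> m = (if m \<in> ?B
      then b0 ^ lookup m 0 * b1 ^ lookup m 1 * b2 ^ lookup m 2 * b3 ^ lookup m 3 else 0)" for m
  define \<phi> where "\<phi> p = (\<Sum>m\<in>?B. \<psi> m * lookup p m)" for p
  have fin: "finite ?B" by (simp add: extremal_support_def)
  have \<phi>_add: "\<phi> (p + q) = \<phi> p + \<phi> q" for p q
    by (simp add: \<phi>_def lookup_add algebra_simps sum.distrib)
  have \<phi>_0: "\<phi> 0 = 0" by (simp add: \<phi>_def)
  have \<phi>_sum: "\<phi> (sum f A) = (\<Sum>i\<in>A. \<phi> (f i))" for f and A :: "nat set"
    by (induction A rule: infinite_finite_induct) (auto simp: \<phi>_0 \<phi>_add)
  have \<phi>_single: "\<phi> (single m c) = \<psi> m * c" for m c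
  proof -
    have "\<phi> (single m c) = (\<Sum>m'\<in>?B. if m' = m then \<psi> m * c else 0)"
      unfolding \<phi>_def by (intro sum.cong) (auto simp: lookup_single when_def)
    then show ?thesis using fin by (simp add: \<psi>_def)
  qed
  have \<phi>_ideal: "\<phi> p = 0" if "p \<in> upset_ideal n ?E" for p
  proof -
    have "m \<notin> keys p" if "m \<in> ?B" for m
      using upset_ideal_degree_eq[OF extremal_generators_subset \<open>p \<in> upset_ideal n ?E\<close>, of m] that
      by (auto simp: extremal_generators_def extremal_support_def mons_def)
    then show ?thesis unfolding \<phi>_def by (intro sum.neutral) (auto simp: in_keys_iff)
  qed
  have \<psi>_sum: "(\<Sum>i<n. a i * \<psi> (m + single i 1)) = 0" if m: "m \<in> mons n e" for m
  proof -
    \<comment> \<open>The first four exponents of \<open>m\<close> sum to at most \<open>e\<close>,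
      so a shift by any further variable never reaches the support.\<close>
    have inB: "m + single i 1 \<in> ?B \<longleftrightarrow>
        (if i < 2 then lookup m 0 + lookup m 1 = 0 \<and> lookup m 2 + lookup m 3 = e
         else i < 4 \<and> lookup m 0 + lookup m 1 = 1 \<and> Suc (lookup m 2 + lookup m 3) = e)" if "i < n" for i
    proof -
      have "m + single i 1 \<in> mons n (Suc e)" using mons_add_single[OF m that] .
      moreover have "lookup m 0 + lookup m 1 + (lookup m 2 + lookup m 3) \<le> e"
      proof -
        have "(\<Sum>k\<in>{0, 1, 2, 3}. lookup m k) \<le> (\<Sum>k<n. lookup m k)"
          using n by (intro sum_mono2) auto
        then show ?thesis using mons_total[OF m] by simp
      qed
      moreover have "i = 0 \<or> i = 1 \<or> i = 2 \<or> i = 3 \<or> 4 \<le> i" by linarith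
      ultimately show ?thesis
        by (elim disjE) (auto simp: extremal_support_def lookup_add lookup_single)
    qed
    have "(\<Sum>i<n. a i * \<psi> (m + single i 1)) = (\<Sum>i\<in>{0, 1, 2, 3}. a i * \<psi> (m + single i 1))"
      using n by (intro sum.mono_neutral_right) (auto simp: \<psi>_def inB[unfolded One_nat_def])
    also have "\<dots> = (a 0 * \<psi> (m + single 0 1) + a 1 * \<psi> (m + single 1 1)) +
        (a 2 * \<psi> (m + single 2 1) + a 3 * \<psi> (m + single 3 1))"
      by simp
    \<comment> \<open>The shifts by both variables of a pair lie in the support together or not at
      all; common powers factor out and leave \<open>a 0 * b0 + a 1 * b1\<close>.\<close>
    also have "a 0 * \<psi> (m + single 0 1) + a 1 * \<psi> (m + single 1 1) = 0"
    proof (cases "m + single 0 1 \<in> ?B")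
      case True
      moreover from this have "m + single 1 1 \<in> ?B" "lookup m 0 = 0" "lookup m 1 = 0"
        using inB[of 0] inB[of 1] n by auto
      ultimately have "a 0 * \<psi> (m + single 0 1) + a 1 * \<psi> (m + single 1 1) =
          (a 0 * b0 + a 1 * b1) * (b2 ^ lookup m 2 * b3 ^ lookup m 3)"
        by (simp add: \<psi>_def lookup_add lookup_single algebra_simps)
      then show ?thesis by (simp only: b01 mult_zero_left)
    qed (use inB[of 0] inB[of 1] n in \<open>auto simp: \<psi>_def\<close>)
    also have "a 2 * \<psi> (m + single 2 1) + a 3 * \<psi> (m + single 3 1) = 0"
    proof (cases "m + single 2 1 \<in> ?B")
      case True
      moreover from this have "m + single 3 1 \<in> ?B"
        using inB[of 2] inB[of 3] n by auto
      ultimately have "a 2 * \<psi> (m + single 2 1) + a 3 * \<psi> (m + single 3 1) =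
          (a 2 * b2 + a 3 * b3) *
          (b0 ^ lookup m 0 * b1 ^ lookup m 1 * b2 ^ lookup m 2 * b3 ^ lookup m 3)"
        by (simp add: \<psi>_def lookup_add lookup_single algebra_simps)
      then show ?thesis by (simp only: b23 mult_zero_left)
    qed (use inB[of 2] inB[of 3] n in \<open>auto simp: \<psi>_def\<close>)
    finally show ?thesis by simp
  qed
  have \<phi>_mult: "\<phi> (l * q) = 0" if q: "q \<in> graded_part n (int e)" for q
  proof -
    have "q \<in> {f. \<phi> (l * f) = 0}"
    proof (rule mpoly_closure)
      fix m assume "m \<in> keys q"
      then have m: "m \<in> mons n e" by (rule keys_graded_part[OF q])
      have "l * single m (lookup q m) = (\<Sum>i<n. single (m + single i 1) (a i * lookup q m))"
        by (subst linear_form_eq[OF l])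
          (simp add: sum_distrib_right mult_single a_def add.commute)
      then have "\<phi> (l * single m (lookup q m)) =
          (\<Sum>i<n. a i * \<psi> (m + single i 1)) * lookup q m"
        by (simp only: \<phi>_sum \<phi>_single sum_distrib_right) (simp only: mult_ac)
      then show "single m (lookup q m) \<in> {f. \<phi> (l * f) = 0}"
        by (simp only: \<psi>_sum[OF m] mult_zero_left mem_Collect_eq)
    qed (auto simp: \<phi>_0 \<phi>_add distrib_left)
    then show ?thesis by simp
  qed
  obtain i :: nat where i: "i \<in> {0, 1}" "i = 0 \<longrightarrow> b0 \<noteq> 0" "i = 1 \<longrightarrow> b1 \<noteq> 0"
  proof (cases "b0 = 0")
    case True
    then show ?thesis using b01(1) by (intro that[of 1]) auto
  qed (use that[of 0] in auto)
  obtain j :: nat where j: "j \<in> {2, 3}" "j = 2 \<longrightarrow> b2 \<noteq> 0" "j = 3 \<longrightarrow> b3 \<noteq> 0"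
  proof (cases "b2 = 0")
    case True
    then show ?thesis using b23(1) by (intro that[of 3]) auto
  qed (use that[of 2] in auto)
  \<comment> \<open>A support monomial built only from variables with nonzero coefficient in the two
    chosen linear forms, so that \<open>\<psi> m\<close> is nonzero.\<close>
  define m where "m = single i 1 + single j e"
  have mB: "m \<in> ?B"
    using i(1) j(1) n
    by (auto simp: m_def extremal_support_def mons_def keys_add_nat total_degree_add lookup_add
        lookup_single when_def)
  then have \<psi>m: "\<psi> m \<noteq> 0"
    using i j by (auto simp: \<psi>_def m_def lookup_add lookup_single when_def split: if_splits)
  show ?thesis
  proof (intro bexI[of _ "single m 1"] ballI notI)
    fix q assume q: "q \<in> graded_part n (int e)" "single m 1 - l * q \<in> upset_ideal n ?E"
    have "\<psi> m = \<phi> ((single m 1 - l * q) + l * q)" by (simp add: \<phi>_single)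
    also have "\<dots> = 0" using \<phi>_add[of "single m 1 - l * q" "l * q"] \<phi>_ideal[OF q(2)] \<phi>_mult[OF q(1)]
      by simp
    finally show False using \<psi>m by simp
  next
    show "single m 1 \<in> graded_part n (int e + 1)"
      using single_in_graded_part[of m n "Suc e" 1] mB
      by (simp add: extremal_support_def add.commute)
  qed
qed

section \<open>The bound and its sharpness\<close>

theorem theorem1p2:
  fixes n d :: nat
  assumes "n \<ge> 4" and "d \<ge> 2"
  shows "(\<forall>I :: 'k::field_char_0 mpoly set.
            artinian_ideal n I \<and> monomial_ideal n I \<and> generated_in_degree n (int d) I \<and>
            \<not> weak_lefschetz n I \<longrightarrow> hilbert_function n I (int d) \<ge> 2 * d) \<and>
         (\<exists>I :: 'k mpoly set.
            artinian_ideal n I \<and> monomial_ideal n I \<and> generated_in_degree n (int d) I \<and>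
            \<not> weak_lefschetz n I \<and> hilbert_function n I (int d) = 2 * d)"
proof (intro conjI allI impI)
  fix I :: "'k mpoly set"
  assume I: "artinian_ideal n I \<and> monomial_ideal n I \<and> generated_in_degree n (int d) I \<and>
    \<not> weak_lefschetz n I"
  then obtain E where E: "E \<subseteq> mons n d" "I = upset_ideal n E"
    using monomial_ideal_generated_in_degree by blast
  have "single i d \<in> E" if "i < n" for i
    using pure_power_if_artinian[OF _ E(1) that] I E(2) by blast
  then have "\<not> card (mons n d - E) < 2 * d"
    using weak_lefschetz_if_small[OF _ E(1)] I E(2) assms by auto
  then show "hilbert_function n I (int d) \<ge> 2 * d"
    unfolding E(2) using assms(2) by (subst hilbert_function_upset_ideal[OF E(1)]) auto
next
  obtain e where e: "d = Suc e" "e \<ge> 1" using assms(2) by (cases d) auto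
  let ?E = "extremal_generators n e"
  let ?I = "upset_ideal n ?E :: 'k mpoly set"
  have sub: "?E \<subseteq> mons n d" unfolding e(1) by (rule extremal_generators_subset)
  have "artinian_ideal n ?I"
    using pure_power_extremal[OF e(2)] by (rule artinian_upset_ideal)
  moreover have "monomial_ideal n ?I" "generated_in_degree n (int d) ?I"
    using upset_ideal_generated[OF sub] by auto
  \<comment> \<open>For every linear form both alternatives fail in the same degree
    \<open>j = e\<close>.\<close>
  moreover have "\<not> weak_lefschetz n ?I"
    unfolding weak_lefschetz_iff[OF ideal_upset_ideal]
    using extremal_not_injective[OF assms(1) e(2)] extremal_not_surjective[OF assms(1) e(2)] by meson
  moreover have "hilbert_function n ?I (int d) = 2 * d"
    using hilbert_function_upset_ideal[OF sub] card_extremal_support[OF assms(1)] e(1)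
    by (simp add: mons_diff_extremal_generators)
  ultimately show "\<exists>I :: 'k mpoly set.
      artinian_ideal n I \<and> monomial_ideal n I \<and> generated_in_degree n (int d) I \<and>
      \<not> weak_lefschetz n I \<and> hilbert_function n I (int d) = 2 * d" by blast
qed

end
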